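(* Let $\varphi$ be the Laplace transform of a random variable $Z>0$. (a) For integers $j\ge 0$, $k\ge 1$ and $\theta\in\Theta$, let $N_\theta$ be a non-negative integer valued random variable with PGF $P_\theta(s)=s^j\varphi\{(1-s^k)/\theta\}$ (so $P_\theta\in\wp_\varphi(s)$), and let $\{X_{\theta,i};\,i\ge 1\}$ be i.i.d. real random variables independent of $N_\theta$. Let $\{\theta_n\}\subset\Theta$ with $\theta_n\downarrow 0$ and let $\{k_n\}$ be a sequence of natural numbers such that $X_{\theta_n,1}+\dots+X_{\theta_n,k_n}$ converges in distribution to a random variable $U$, which is infinitely divisible. If the $N_\theta$-sums $X_{\theta,1}+\dots+X_{\theta,N_\theta}$ converge in distribution as $\theta\downarrow 0$ through $\{\theta_n\}$, then the limit law is necessarily $\varphi$-ID. (b) Conversely, every $\varphi$-ID law can be obtained, for each member of $\wp_\varphi(s)$ (that is, for each choice of integers $j\ge 0$, $k\ge 1$, with $N_\theta$ having PGF $s^j\varphi\{(1-s^k)/\theta\}$), as the limit law of $N_\theta$-sums of i.i.d. random variables (independent of $N_\theta$) as $\theta\downarrow 0$.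
   Context: $\Theta\subset(0,\infty)$ is a parameter set having $0$ as a limit point. The Laplace transform of $Z>0$ is $\varphi(v)=E(e^{-vZ})$, defined for complex $v$ with $\mathrm{Re}\,v\ge 0$. PGF means probability generating function, CF characteristic function, ID infinitely divisible. For an ID CF $\omega$, $\log\omega$ is the continuous branch with $\log\omega(0)=0$. The class $\wp_\varphi(s)=\{P_\theta(s)=s^j\varphi[(1-s^k)/\theta],\ 0<s<1,\ j\ge 0,\ k\ge 1\text{ integers},\ \theta>0\}$ consists of PGFs; $j$ and $k$ stay fixed as $\theta\downarrow 0$. An $N_\theta$-sum is the random sum $X_{\theta,1}+\dots+X_{\theta,N_\theta}$ (equal to $0$ if $N_\theta=0$); its CF is $P_\theta\{h_\theta\}$, where $h_\theta$ is the CF of $X_{\theta,1}$. For the fixed Laplace transform $\varphi$, a CF $f$ (and its law) is called $\varphi$-ID if for every $\theta\in\Theta$ there exist a CF $h_\theta$ and a PGF $P_\theta$ (of a non-negative integer valued random variable $N_\theta$ independent of the variables having CF $h_\theta$) such that $P_\theta\{h_\theta(t)\}\to f(t)=\varphi\{-\log\omega(t)\}$ for all $t\in\mathbf{R}$ as $\theta\downarrow 0$ through some sequence $\{\theta_n\}\subset\Theta$, where $\omega$ is a CF that is ID. *)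

theory Defs
  imports "HOL-Probability.Probability"
begin

definition laplace_transform :: "'z measure \<Rightarrow> ('z \<Rightarrow> real) \<Rightarrow> complex \<Rightarrow> complex" where
  "laplace_transform M Z v = (CLINT x|M. exp (- v * of_real (Z x)))"

definition is_cf :: "(real \<Rightarrow> complex) \<Rightarrow> bool" where
  "is_cf f \<longleftrightarrow> (\<exists>\<mu>. real_distribution \<mu> \<and> f = char \<mu>)"

definition infinitely_divisible_cf :: "(real \<Rightarrow> complex) \<Rightarrow> bool" where
  "infinitely_divisible_cf f \<longleftrightarrow>
     is_cf f \<and> (\<forall>n\<ge>1::nat. \<exists>g. is_cf g \<and> (\<forall>t. f t = g t ^ n))"

text \<open>The continuous branch of the logarithm vanishing at 0; it exists and is unique whenever
  \<open>\<omega>\<close> is continuous and zero-free with \<open>\<omega> 0 = 1\<close>, in particular for an infinitely divisible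
  characteristic function. The principal logarithm \<open>Ln\<close> would not do.\<close>

definition cf_log :: "(real \<Rightarrow> complex) \<Rightarrow> real \<Rightarrow> complex" where
  "cf_log \<omega> = (THE g. continuous_on UNIV g \<and> g 0 = 0 \<and> (\<forall>t. exp (g t) = \<omega> t))"

definition pgf :: "'a measure \<Rightarrow> ('a \<Rightarrow> nat) \<Rightarrow> complex \<Rightarrow> complex" where
  "pgf M N s = (CLINT x|M. s ^ N x)"

definition is_pgf :: "(complex \<Rightarrow> complex) \<Rightarrow> bool" where
  "is_pgf P \<longleftrightarrow> (\<exists>p :: nat pmf. \<forall>s. norm s \<le> 1 \<longrightarrow> P s = pgf (measure_pmf p) id s)"

definition wp_member ::
    "(complex \<Rightarrow> complex) \<Rightarrow> nat \<Rightarrow> nat \<Rightarrow> real \<Rightarrow> complex \<Rightarrow> complex" where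
  "wp_member \<phi> j k \<theta> s = s ^ j * \<phi> ((1 - s ^ k) / of_real \<theta>)"

definition phi_ID :: "real set \<Rightarrow> (complex \<Rightarrow> complex) \<Rightarrow> (real \<Rightarrow> complex) \<Rightarrow> bool" where
  "phi_ID \<Theta> \<phi> f \<longleftrightarrow>
     is_cf f \<and>
     (\<exists>h P \<omega>.
        (\<forall>\<theta>\<in>\<Theta>. is_cf (h \<theta>) \<and> is_pgf (P \<theta>)) \<and>
        infinitely_divisible_cf \<omega> \<and>
        (\<forall>t. f t = \<phi> (- cf_log \<omega> t)) \<and>
        (\<exists>\<theta>s :: nat \<Rightarrow> real. (\<forall>n. \<theta>s n \<in> \<Theta>) \<and> decseq \<theta>s \<and> \<theta>s \<longlonglongrightarrow> 0 \<and>
           (\<forall>t. (\<lambda>n. P (\<theta>s n) (h (\<theta>s n) t)) \<longlonglongrightarrow> f t)))"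

text \<open>Library independence of families is homogeneously typed, so \<open>N\<close> enters as a real variable
  at position 0 of one jointly independent family \<open>N, X 0, X 1, \<dots>\<close>; this says that the \<open>X i\<close> are
  independent and that \<open>N\<close> is independent of the whole sequence \<open>X\<close>, and includes measurability.\<close>

definition iid_with_index :: "'a measure \<Rightarrow> ('a \<Rightarrow> nat) \<Rightarrow> (nat \<Rightarrow> 'a \<Rightarrow> real) \<Rightarrow> bool" where
  "iid_with_index M N X \<longleftrightarrow>
     prob_space M \<and>
     prob_space.indep_vars M (\<lambda>_. borel) (case_nat (\<lambda>x. real (N x)) X) (UNIV :: nat set) \<and>
     (\<forall>i. distr M borel (X i) = distr M borel (X 0))"

text \<open>The summands are numbered from 0, so the partial sum of the first \<open>n\<close> of them ranges over
  \<open>i < n\<close>.\<close>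

definition sum_law :: "'a measure \<Rightarrow> ('a \<Rightarrow> nat) \<Rightarrow> (nat \<Rightarrow> 'a \<Rightarrow> real) \<Rightarrow> real measure" where
  "sum_law M N X = distr M borel (\<lambda>x. \<Sum>i<N x. X i x)"

end

theory Submission
  imports Defs "HOL-Complex_Analysis.Cauchy_Integral_Formula"
begin

text \<open>
  An \<open>N\<^sub>\<theta>\<close>-sum has characteristic function \<open>h ^ j * \<phi> \<psi>\<close> with \<open>\<psi> = (1 - h ^ k) / \<theta>\<close>, where
  \<open>exp (- \<psi>)\<close> is a compound Poisson characteristic function. If the sums converge, their
  characteristic functions are close to 1 near 0, uniformly in \<open>\<theta>\<close>. Then \<open>Re \<psi>\<close> is bounded near 0,
  so \<open>h\<close> tends to 1 and \<open>\<phi> \<psi>\<close> is close to 1. The equation \<open>\<phi> v = 1\<close> has no solution on small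
  half-circles around 0 in \<open>Re v \<ge> 0\<close>, so the curve \<open>\<psi>\<close>, which starts at 0, is trapped near 0. Hence
  the compound Poisson laws are tight; a subsequence converges to an infinitely divisible \<open>\<omega>\<close>, the
  exponents \<open>- \<psi>\<close> converge to the continuous logarithm of \<open>\<omega>\<close>, and the limit is \<open>\<phi> (- log \<omega>)\<close>.

  Conversely, for \<open>\<phi> (- log \<omega>)\<close> take \<open>h\<^sub>\<theta>\<close> to be the root of \<open>\<omega>\<close> of order \<open>k\<close> times the ceiling of
  \<open>1 / \<theta>\<close>, for which \<open>(1 - h\<^sub>\<theta> ^ k) / \<theta>\<close> tends to \<open>- log \<omega>\<close>.
\<close>

section \<open>Characteristic functions and continuous logarithms\<close>

text \<open>\<open>\<phi>\<close> need not be injective on the half-plane Re v \<ge> 0, so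
  convergence of \<open>\<phi> \<psi>\<close> cannot simply be inverted; likewise
  \<open>h ^ k\<close> close to 1 allows \<open>h\<close> near any k-th root of unity, and
  \<open>exp (- \<psi>)\<close> fixes \<open>\<psi>\<close> only up to multiples of 2 pi i. All
  three ambiguities fall to one topological argument: the curve starts at a known point, and a
  connected set cannot leave a small ball without crossing a sphere on which the target value is
  excluded. For \<open>\<phi>\<close> this is done near 0 only. Tightness asks for nothing more, and
  compactness then supplies a limit on the whole line. The factor \<open>h ^ j\<close> has to
  disappear at every t, so convergence of \<open>h\<close> to 1 is carried from a neighbourhood of 0
  to the line by the doubling inequality.\<close>

lemma is_cfE:
  assumes "is_cf f"
  obtains \<mu> where "real_distribution \<mu>" "f = char \<mu>"
  using assms unfolding is_cf_def by blast

lemma is_cf_char: "real_distribution \<mu> \<Longrightarrow> is_cf (char \<mu>)"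
  unfolding is_cf_def by blast

lemma is_cf_continuous: "is_cf f \<Longrightarrow> continuous_on A f"
  by (metis is_cfE real_distribution.isCont_char continuous_at_imp_continuous_on)

lemma is_cf_0: "is_cf f \<Longrightarrow> f 0 = 1"
  by (metis is_cfE real_distribution.char_zero)

lemma is_cf_norm_le_1: "is_cf f \<Longrightarrow> norm (f t) \<le> 1"
  by (metis is_cfE real_distribution.cmod_char_le_1)

text \<open>In the unit disc the real part alone controls the distance to 1. This serves the
  doubling inequality, the equation \<open>exp (- v Z) = 1\<close> and the closeness of
  \<open>h ^ k\<close> to 1.\<close>

lemma norm_sq_one_minus_le:
  assumes "norm (z::complex) \<le> 1"
  shows "(norm (1 - z))\<^sup>2 \<le> 2 * (1 - Re z)"
proof -
  have "(norm (1 - z))\<^sup>2 = 1 - 2 * Re z + (norm z)\<^sup>2"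
    unfolding cmod_power2 by (simp add: power2_eq_square algebra_simps)
  moreover have "(norm z)\<^sup>2 \<le> 1" using assms by (simp add: power_le_one)
  ultimately show ?thesis by simp
qed

text \<open>Integrate \<open>(1 - z\<^sup>2) - 2 (1 - z) = - (1 - z)\<^sup>2\<close> with \<open>z = exp (i t x)\<close>, for which
  \<open>|1 - z|\<^sup>2 = 2 (1 - Re z)\<close>.\<close>

lemma is_cf_doubling:
  assumes "is_cf f"
  shows "norm (1 - f (2 * t)) \<le> 4 * norm (1 - f t)"
proof -
  obtain \<mu> where \<mu>: "real_distribution \<mu>" and f: "f = char \<mu>" using assms by (rule is_cfE)
  interpret real_distribution \<mu> by (rule \<mu>)
  let ?z = "\<lambda>x. iexp (t * x)"
  have [simp]: "prob UNIV = 1" using prob_space by simp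
  have [simp]: "integrable \<mu> (\<lambda>x. iexp (s * x))" for s by (intro integrable_iexp) auto
  have int: "integrable \<mu> (\<lambda>x. (1 - ?z x)\<^sup>2)"
    by (rule integrable_const_bound[where B = 4])
       (auto simp: norm_power intro!: AE_I2 order_trans[OF power_mono[OF norm_triangle_ineq4]])
  have sq: "(iexp (t * x))\<^sup>2 = iexp (2 * t * x)" for x
    unfolding exp_double[symmetric] by (rule arg_cong[of _ _ exp]) (simp add: algebra_simps)
  have "(CLINT x|\<mu>. (1 - ?z x)\<^sup>2) = (CLINT x|\<mu>. 1 - 2 * ?z x + iexp (2 * t * x))"
    unfolding sq[symmetric] by (intro Bochner_Integration.integral_cong refl) (simp add: power2_diff)
  also have "\<dots> = 1 - 2 * f t + f (2 * t)"
    by (simp add: f char_def del: of_real_mult)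
  finally have eq: "1 - f (2 * t) = 2 * (1 - f t) - (CLINT x|\<mu>. (1 - ?z x)\<^sup>2)"
    by (simp add: algebra_simps)
  have "norm (CLINT x|\<mu>. (1 - ?z x)\<^sup>2) \<le> (LINT x|\<mu>. norm ((1 - ?z x)\<^sup>2))"
    by (rule integral_norm_bound)
  also have "\<dots> \<le> (LINT x|\<mu>. 2 * (1 - Re (?z x)))"
  proof (rule integral_mono)
    show "integrable \<mu> (\<lambda>x. 2 * (1 - Re (?z x)))"
      by (intro integrable_mult_right Bochner_Integration.integrable_diff integrable_Re) (auto simp del: of_real_mult)
    show "norm ((1 - ?z x)\<^sup>2) \<le> 2 * (1 - Re (?z x))" for x
      unfolding norm_power by (rule norm_sq_one_minus_le) simp
  qed (rule integrable_norm[OF int])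
  also have "\<dots> = 2 * (1 - Re (f t))"
    by (simp add: f char_def del: Re_exp of_real_mult)
  also have "\<dots> \<le> 2 * norm (1 - f t)" using complex_Re_le_cmod[of "1 - f t"] by simp
  finally have "norm (CLINT x|\<mu>. (1 - ?z x)\<^sup>2) \<le> 2 * norm (1 - f t)" .
  moreover have "norm (2 * (1 - f t)) = 2 * norm (1 - f t)" by (simp only: norm_mult norm_numeral)
  \<comment> \<open>The factor 4 is 2 from the linear term plus 2 from the integral.\<close>
  ultimately show ?thesis
    unfolding eq using norm_triangle_ineq4[of "2 * (1 - f t)" "CLINT x|\<mu>. (1 - ?z x)\<^sup>2"]
    by linarith
qed

text \<open>Symmetrization: the difference of two independent copies has transform
  \<open>f t * cnj (f t)\<close>. Information on the modulus of \<open>f\<close> thus becomes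
  information on a characteristic function, to which doubling applies.\<close>

lemma is_cf_norm_sq:
  assumes "is_cf f"
  shows "is_cf (\<lambda>t. of_real ((norm (f t))\<^sup>2))"
proof -
  obtain \<mu> where \<mu>: "real_distribution \<mu>" and f: "f = char \<mu>" using assms by (rule is_cfE)
  interpret real_distribution \<mu> by (rule \<mu>)
  interpret P: pair_prob_space \<mu> \<mu> ..
  let ?D = "distr (\<mu> \<Otimes>\<^sub>M \<mu>) borel (\<lambda>(x, y). x - y)"
  have [measurable]: "(\<lambda>(x, y). x - y) \<in> borel_measurable (\<mu> \<Otimes>\<^sub>M \<mu>)" by simp
  have "real_distribution ?D"
    by (intro real_distribution.intro P.prob_space_distr) (auto simp: real_distribution_axioms_def)
  moreover have "char ?D t = of_real ((norm (f t))\<^sup>2)" for t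
  proof -
    have int: "integrable (\<mu> \<Otimes>\<^sub>M \<mu>) (\<lambda>(x, y). iexp (t * (x - y)))"
      by (rule P.integrable_const_bound[where B = 1]) (auto simp: split_beta')
    have "char ?D t = (CLINT p|(\<mu> \<Otimes>\<^sub>M \<mu>). (case p of (x, y) \<Rightarrow> iexp (t * (x - y))))"
      unfolding char_def by (subst integral_distr) (auto simp: split_beta')
    also have "\<dots> = (CLINT x|\<mu>. CLINT y|\<mu>. iexp (t * (x - y)))"
      using P.integral_fst'[OF int] by simp
    also have "\<dots> = (CLINT x|\<mu>. CLINT y|\<mu>. iexp (t * x) * cnj (iexp (t * y)))"
      by (simp add: exp_cnj exp_add[symmetric] algebra_simps)
    also have "\<dots> = f t * cnj (f t)"
      by (simp add: f char_def flip: integral_cnj)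
    finally show ?thesis unfolding complex_norm_square .
  qed
  ultimately show ?thesis unfolding is_cf_def by (metis (no_types, lifting) ext)
qed

text \<open>If \<open>\<omega> t \<noteq> 0\<close>, an \<open>n\<close>-th root of \<open>\<omega>\<close> is close to modulus 1 at \<open>t\<close> for large \<open>n\<close>, hence
  by doubling it cannot vanish at \<open>2 t\<close>.\<close>

lemma infinitely_divisible_cf_nonzero:
  assumes "infinitely_divisible_cf \<omega>"
  shows "\<omega> t \<noteq> 0"
proof -
  have cf: "is_cf \<omega>" and root: "\<And>n::nat. n \<ge> 1 \<Longrightarrow> \<exists>g. is_cf g \<and> (\<forall>t. \<omega> t = g t ^ n)"
    using assms unfolding infinitely_divisible_cf_def by auto
  have double: "\<omega> (2 * t) \<noteq> 0" if t: "\<omega> t \<noteq> 0" for t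
  proof -
    define c where "c = (norm (\<omega> t))\<^sup>2"
    have c: "c > 0" using t by (simp add: c_def)
    have "(\<lambda>n. root n c) \<longlonglongrightarrow> 1" by (rule LIMSEQ_root_const[OF c])
    \<comment> \<open>3/4 is dictated by the doubling factor: 4 (1 - 3/4) = 1, so the squared
      modulus of the root at \<open>2 * t\<close> is less than 1 away from 1.\<close>
    hence "eventually (\<lambda>n. root n c > 3/4) sequentially"
      by (rule order_tendstoD) simp
    then obtain n where n: "n \<ge> 1" "root n c > 3/4"
      unfolding eventually_sequentially by (metis nat_le_linear)
    obtain g where g: "is_cf g" "\<And>t. \<omega> t = g t ^ n" using root[OF n(1)] by blast
    have "c = ((norm (g t))\<^sup>2) ^ n"
      by (simp add: c_def g norm_power mult.commute flip: power_mult)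
    hence "root n c = (norm (g t))\<^sup>2" using n by (simp add: real_root_power_cancel)
    hence gt: "(norm (g t))\<^sup>2 > 3/4" using n by simp
    have le1: "(norm (g t))\<^sup>2 \<le> 1" using is_cf_norm_le_1[OF g(1)] by (simp add: power_le_one)
    have "norm (1 - complex_of_real ((norm (g (2*t)))\<^sup>2)) \<le>
        4 * norm (1 - complex_of_real ((norm (g t))\<^sup>2))"
      by (rule is_cf_doubling[OF is_cf_norm_sq[OF g(1)]])
    also have "\<dots> = 4 * (1 - (norm (g t))\<^sup>2)"
      using le1 by (metis norm_of_real of_real_1 of_real_diff abs_of_nonneg diff_ge_0_iff_ge)
    also have "\<dots> < 1" using gt by simp
    finally have "g (2 * t) \<noteq> 0" by auto
    thus ?thesis by (simp add: g)
  qed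
  have "eventually (\<lambda>s. \<omega> s \<noteq> 0) (at 0)"
  proof (rule tendsto_imp_eventually_ne)
    show "(\<omega> \<longlongrightarrow> 1) (at 0)"
      using is_cf_continuous[OF cf, of UNIV] is_cf_0[OF cf]
      by (metis continuous_on_eq_continuous_at isCont_def open_UNIV UNIV_I)
  qed simp
  then obtain d where d: "d > 0" "\<And>s. \<bar>s\<bar> < d \<Longrightarrow> \<omega> s \<noteq> 0"
    unfolding eventually_at using is_cf_0[OF cf] by (auto simp: dist_real_def) (metis zero_neq_one)
  \<comment> \<open>Halving \<open>t\<close> often enough reaches the neighbourhood of 0 where
    \<open>\<omega>\<close> has no zeros; \<open>double\<close> then leads back to
    \<open>t\<close>.\<close>
  obtain n where n: "\<bar>t\<bar> / d < 2 ^ n" using real_arch_pow[of 2] by auto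
  have "\<bar>t / 2 ^ n\<bar> < d" using n d(1) by (simp add: field_simps)
  hence 0: "\<omega> (t / 2 ^ n) \<noteq> 0" by (rule d)
  have "\<omega> (2 ^ i * (t / 2 ^ n)) \<noteq> 0" for i
  proof (induction i)
    case (Suc i) thus ?case using double[of "2 ^ i * (t / 2 ^ n)"] by (simp add: mult_ac)
  qed (use 0 in simp)
  from this[of n] show ?thesis by simp
qed

text \<open>The difference takes values in 2 pi i times the integers. Distinct values are at least 2
  pi apart, so a continuous difference is constant.\<close>

lemma continuous_log_unique:
  fixes f g :: "real \<Rightarrow> complex"
  assumes "continuous_on UNIV f" "continuous_on UNIV g" "f 0 = g 0" "\<And>t. exp (f t) = exp (g t)"
  shows "f = g"
proof -
  have "(\<lambda>t. f t - g t) constant_on UNIV"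
  proof (rule continuous_discrete_range_constant)
    show "continuous_on UNIV (\<lambda>t. f t - g t)" by (intro continuous_intros assms)
    show "\<exists>e>0. \<forall>y. y \<in> UNIV \<and> f y - g y \<noteq> f x - g x \<longrightarrow> e \<le> norm (f y - g y - (f x - g x))" for x
    proof (intro exI[of _ "2 * pi"] conjI allI impI)
      fix y assume ne: "y \<in> UNIV \<and> f y - g y \<noteq> f x - g x"
      have e1: "exp (f t - g t) = 1" for t using assms(4)[of t] by (simp add: exp_diff)
      have "exp ((f y - g y) - (f x - g x)) = 1" unfolding exp_diff[of "f y - g y"] e1 by simp
      then obtain n :: int where n: "Re ((f y - g y) - (f x - g x)) = 0"
          "Im ((f y - g y) - (f x - g x)) = of_int (2 * n) * pi"
        unfolding exp_eq_1 by auto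
      have "n \<noteq> 0"
      proof
        assume "n = 0"
        hence "(f y - g y) - (f x - g x) = 0" using n by (intro complex_eqI) auto
        thus False using ne by simp
      qed
      hence "1 \<le> \<bar>real_of_int n\<bar>" by linarith
      hence "2 * pi \<le> \<bar>Im ((f y - g y) - (f x - g x))\<bar>" unfolding n by (simp add: abs_mult)
      also have "\<dots> \<le> norm ((f y - g y) - (f x - g x))" by (rule abs_Im_le_cmod)
      finally show "2 * pi \<le> norm (f y - g y - (f x - g x))" .
    qed simp
  qed simp
  then obtain c where "\<And>t. f t - g t = c" unfolding constant_on_def by auto
  thus ?thesis using assms(3) by (metis eq_iff_diff_eq_0 ext)
qed

lemma cf_log_eqI:
  assumes "continuous_on UNIV g" "g 0 = 0" "\<And>t. exp (g t) = \<omega> t"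
  shows "cf_log \<omega> = g"
  unfolding cf_log_def using assms
  by (intro the_equality) (auto intro!: continuous_log_unique)

text \<open>A continuous zero-free function on the contractible real line has a continuous
  logarithm; subtracting its value at 0 keeps the exponential because \<open>\<omega> 0 = 1\<close>.
  The description behind \<open>cf_log\<close> is thereby meaningful.\<close>

lemma infinitely_divisible_cf_log:
  assumes "infinitely_divisible_cf \<omega>"
  shows "continuous_on UNIV (cf_log \<omega>)" "cf_log \<omega> 0 = 0" "exp (cf_log \<omega> t) = \<omega> t"
proof -
  have cf: "is_cf \<omega>" using assms unfolding infinitely_divisible_cf_def by auto
  obtain g where g: "continuous_on UNIV g" "\<And>t. \<omega> t = exp (g t)"
    using continuous_logarithm_on_contractible[OF is_cf_continuous[OF cf, of UNIV]
        contractible_UNIV infinitely_divisible_cf_nonzero[OF assms]] by auto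
  define g' where "g' t = g t - g 0" for t
  have g': "continuous_on UNIV g'" "g' 0 = 0" "\<And>t. exp (g' t) = \<omega> t"
    unfolding g'_def using g is_cf_0[OF cf] by (auto intro!: continuous_intros simp: exp_diff)
  note cf_log_eqI[OF this]
  thus "continuous_on UNIV (cf_log \<omega>)" "cf_log \<omega> 0 = 0" "exp (cf_log \<omega> t) = \<omega> t"
    using g' by simp_all
qed

lemma infinitely_divisible_cf_log_Re_le_0:
  assumes "infinitely_divisible_cf \<omega>"
  shows "Re (cf_log \<omega> t) \<le> 0"
proof -
  have "is_cf \<omega>" using assms unfolding infinitely_divisible_cf_def by auto
  hence "norm (exp (cf_log \<omega> t)) \<le> 1"
    using infinitely_divisible_cf_log(3)[OF assms] is_cf_norm_le_1 by simp
  thus ?thesis by simp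
qed

text \<open>\<open>n\<close> times the continuous logarithm of \<open>g\<close> is a continuous
  logarithm of \<open>\<omega>\<close> vanishing at 0, hence \<open>cf_log \<omega>\<close>. The
  roots promised by infinite divisibility thus become explicit.\<close>

lemma cf_root_eq_exp:
  assumes "infinitely_divisible_cf \<omega>" "is_cf g" "\<And>t. \<omega> t = g t ^ n" "n \<ge> 1"
  shows "g t = exp (cf_log \<omega> t / of_nat n)"
proof -
  note L = infinitely_divisible_cf_log[OF assms(1)]
  have nz: "g t \<noteq> 0" for t
    using infinitely_divisible_cf_nonzero[OF assms(1), of t] assms(3,4) by auto
  obtain l where l: "continuous_on UNIV l" "\<And>t. g t = exp (l t)"
    using continuous_logarithm_on_contractible[OF is_cf_continuous[OF assms(2), of UNIV]
        contractible_UNIV nz] by auto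
  define l' where "l' t = l t - l 0" for t
  have l': "continuous_on UNIV l'" "l' 0 = 0" "\<And>t. exp (l' t) = g t"
    unfolding l'_def using l is_cf_0[OF assms(2)] by (auto intro!: continuous_intros simp: exp_diff)
  have "cf_log \<omega> = (\<lambda>t. of_nat n * l' t)"
  proof (rule cf_log_eqI)
    show "continuous_on UNIV (\<lambda>t. of_nat n * l' t)" by (intro continuous_intros l')
  qed (use l' assms(3) in \<open>simp_all add: exp_of_nat_mult\<close>)
  thus ?thesis using l'(3) assms(4) by simp
qed

text \<open>On the compact part of the sphere in \<open>H\<close>, \<open>F\<close> keeps a positive
  distance \<open>\<epsilon>\<close> from 1. The norms on \<open>C\<close> form an interval
  containing 0, so a point outside the ball would force a point of \<open>C\<close> on the sphere.
  It is applied to \<open>exp\<close>, to \<open>(1 + w) ^ k\<close> and to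
  \<open>\<phi>\<close>.\<close>

lemma connected_within_ball:
  fixes F :: "complex \<Rightarrow> complex"
  assumes H: "closed H" "continuous_on H F" and ne: "\<And>v. v \<in> H \<Longrightarrow> norm v = \<eta> \<Longrightarrow> F v \<noteq> 1"
    and \<eta>: "\<eta> > 0"
  obtains \<epsilon> where "\<epsilon> > 0"
    "\<And>C v. connected C \<Longrightarrow> C \<subseteq> H \<Longrightarrow> 0 \<in> C \<Longrightarrow> (\<And>w. w \<in> C \<Longrightarrow> norm (F w - 1) < \<epsilon>) \<Longrightarrow>
       v \<in> C \<Longrightarrow> norm v < \<eta>"
proof -
  let ?K = "sphere 0 \<eta> \<inter> H"
  have K: "compact ?K" using H(1) by (intro compact_Int_closed) auto
  obtain \<epsilon> where \<epsilon>: "\<epsilon> > 0" "\<And>v. v \<in> ?K \<Longrightarrow> \<epsilon> \<le> norm (F v - 1)"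
  proof (cases "?K = {}")
    case True thus ?thesis using that[of 1] by auto
  next
    case False
    have "continuous_on ?K (\<lambda>v. norm (F v - 1))"
      by (intro continuous_intros continuous_on_subset[OF H(2)]) auto
    then obtain v0 where v0: "v0 \<in> ?K" "\<forall>v\<in>?K. norm (F v0 - 1) \<le> norm (F v - 1)"
      using continuous_attains_inf[OF K False] by blast
    show ?thesis using that[of "norm (F v0 - 1)"] v0 ne[of v0] by auto
  qed
  show ?thesis
  proof (rule that[OF \<epsilon>(1)])
    fix C v assume C: "connected C" "C \<subseteq> H" "0 \<in> C" "\<And>w. w \<in> C \<Longrightarrow> norm (F w - 1) < \<epsilon>" "v \<in> C"
    show "norm v < \<eta>"
    proof (rule ccontr)
      assume "\<not> norm v < \<eta>"
      hence "\<exists>w\<in>C. norm w = \<eta>"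
        using connectedD_interval[OF connected_continuous_image[OF continuous_on_norm[OF continuous_on_id] C(1)],
            of 0 "norm v" \<eta>] C(3,5) \<eta> by (force simp: image_iff)
      thus False using \<epsilon>(2) C(2,4) by fastforce
    qed
  qed
qed

section \<open>Weak convergence and tightness\<close>

text \<open>Realise the laws by almost surely convergent variables (Skorohod) and bound
  \<open>|exp (i t x) - exp (i t y)|\<close> by \<open>min 2 (T |x - y|)\<close>.\<close>

lemma weak_conv_imp_char_uniform_limit:
  assumes \<mu>: "\<And>n. real_distribution (\<mu> n)" and \<nu>: "real_distribution \<nu>" and w: "weak_conv_m \<mu> \<nu>"
  shows "uniform_limit {-T..T} (\<lambda>n. char (\<mu> n)) (char \<nu>) sequentially"
proof -
  obtain \<Omega> :: "real measure" and Ys Y where \<Omega>: "prob_space \<Omega>"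
    and [measurable]: "\<And>n. Ys n \<in> borel_measurable \<Omega>"
    and Ys: "\<And>n. distr \<Omega> borel (Ys n) = \<mu> n" and "Y \<in> measurable \<Omega> lborel"
    and Y: "distr \<Omega> borel Y = \<nu>" and lim: "\<And>x. x \<in> space \<Omega> \<Longrightarrow> (\<lambda>n. Ys n x) \<longlonglongrightarrow> Y x"
    using Skorohod[OF \<mu> \<nu> w] by blast
  then have [measurable]: "Y \<in> borel_measurable \<Omega>" by simp
  interpret prob_space \<Omega> by (rule \<Omega>)
  \<comment> \<open>\<open>B n\<close> does not involve \<open>t\<close>; its convergence to 0 is
    the source of uniformity.\<close>
  define B where "B n = (LINT x|\<Omega>. min 2 (\<bar>T\<bar> * \<bar>Ys n x - Y x\<bar>))" for n
  have "B \<longlonglongrightarrow> (LINT x|\<Omega>. 0)"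
    unfolding B_def
  proof (rule integral_dominated_convergence[where w = "\<lambda>_. 2"])
    show "AE x in \<Omega>. (\<lambda>n. min 2 (\<bar>T\<bar> * \<bar>Ys n x - Y x\<bar>)) \<longlonglongrightarrow> 0"
    proof (rule AE_I2)
      fix x assume "x \<in> space \<Omega>"
      hence "(\<lambda>n. min 2 (\<bar>T\<bar> * \<bar>Ys n x - Y x\<bar>)) \<longlonglongrightarrow> min 2 (\<bar>T\<bar> * \<bar>Y x - Y x\<bar>)"
        by (intro tendsto_intros lim)
      thus "(\<lambda>n. min 2 (\<bar>T\<bar> * \<bar>Ys n x - Y x\<bar>)) \<longlonglongrightarrow> 0" by simp
    qed
  qed auto
  hence B0: "B \<longlonglongrightarrow> 0" by simp
  have bound: "norm (char (\<mu> n) t - char \<nu> t) \<le> B n" if t: "t \<in> {-T..T}" for n t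
  proof -
    have [simp]: "integrable \<Omega> (\<lambda>x. iexp (t * Ys n x))" "integrable \<Omega> (\<lambda>x. iexp (t * Y x))"
      by (intro integrable_iexp; simp)+
    have "char (\<mu> n) t - char \<nu> t = (CLINT x|\<Omega>. iexp (t * Ys n x) - iexp (t * Y x))"
      unfolding char_def Ys[symmetric] Y[symmetric] by (simp add: integral_distr del: of_real_mult)
    also have "norm \<dots> \<le> (LINT x|\<Omega>. norm (iexp (t * Ys n x) - iexp (t * Y x)))"
      by (rule integral_norm_bound)
    also have "\<dots> \<le> B n" unfolding B_def
    proof (rule integral_mono)
      fix x
      have "iexp (t * Ys n x) - iexp (t * Y x) = iexp (t * Y x) * (iexp (t * Ys n x - t * Y x) - 1)"
        by (simp add: algebra_simps flip: exp_add)
      hence "norm (iexp (t * Ys n x) - iexp (t * Y x)) = norm (iexp (t * Ys n x - t * Y x) - 1)"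
        by (simp add: norm_mult)
      also have "\<dots> \<le> \<bar>t * Ys n x - t * Y x\<bar>"
        using iexp_approx1[of "t * Ys n x - t * Y x" 0] by simp
      also have "\<dots> = \<bar>t\<bar> * \<bar>Ys n x - Y x\<bar>" by (simp add: abs_mult flip: right_diff_distrib)
      also have "\<dots> \<le> \<bar>T\<bar> * \<bar>Ys n x - Y x\<bar>" using t by (intro mult_right_mono) auto
      finally show "norm (iexp (t * Ys n x) - iexp (t * Y x)) \<le> min 2 (\<bar>T\<bar> * \<bar>Ys n x - Y x\<bar>)"
        using norm_triangle_ineq4[of "iexp (t * Ys n x)" "iexp (t * Y x)"] by simp
    next
      show "integrable \<Omega> (\<lambda>x. min 2 (\<bar>T\<bar> * \<bar>Ys n x - Y x\<bar>))"
        by (rule integrable_const_bound[where B = 2]) auto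
    qed (auto simp del: of_real_mult)
    finally show ?thesis .
  qed
  show ?thesis
  proof (rule uniform_limitI)
    fix e :: real assume "e > 0"
    hence "eventually (\<lambda>n. B n < e) sequentially" using B0 by (rule order_tendstoD(2)[rotated])
    thus "\<forall>\<^sub>F n in sequentially. \<forall>t\<in>{-T..T}. dist (char (\<mu> n) t) (char \<nu> t) < e"
      by eventually_elim (auto simp: dist_norm intro: le_less_trans[OF bound])
  qed
qed

lemma exp_neq_1:
  assumes "norm v = \<eta>" "0 < \<eta>" "\<eta> < 2 * pi"
  shows "exp v \<noteq> (1::complex)"
proof
  assume "exp v = 1"
  then obtain n :: int where n: "Re v = 0" "Im v = of_int (2 * n) * pi" unfolding exp_eq_1 by auto
  have "norm v = \<bar>Im v\<bar>" using n(1) by (simp add: cmod_eq_Im)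
  hence *: "\<eta> = 2 * pi * \<bar>real_of_int n\<bar>" using assms n by (simp add: abs_mult)
  hence "n \<noteq> 0" using assms by auto
  hence "1 \<le> \<bar>real_of_int n\<bar>" by linarith
  hence "2 * pi * 1 \<le> 2 * pi * \<bar>real_of_int n\<bar>" by (intro mult_left_mono) auto
  thus False using * assms by simp
qed

text \<open>The difference \<open>l n - cf_log \<omega>\<close> starts at 0 and its exponential is
  \<open>exp (l n) / \<omega>\<close>, uniformly near 1 on the interval from 0 to \<open>t\<close>;
  trapping for \<open>exp\<close> keeps the difference small.\<close>

lemma continuous_log_tendsto:
  assumes \<omega>: "infinitely_divisible_cf \<omega>"
    and l: "\<And>n. continuous_on UNIV (l n)" "\<And>n. l n 0 = 0"
    and u: "\<And>T. uniform_limit {-T..T} (\<lambda>n t. exp (l n t)) \<omega> sequentially"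
  shows "(\<lambda>n. l n t) \<longlonglongrightarrow> cf_log \<omega> t"
proof (rule tendstoI)
  fix e :: real assume e: "e > 0"
  note L = infinitely_divisible_cf_log[OF \<omega>]
  have cf: "is_cf \<omega>" using \<omega> unfolding infinitely_divisible_cf_def by auto
  \<comment> \<open>The cap 1 keeps the radius below 2 pi, so that \<open>exp\<close> does not take
    the value 1 on the sphere.\<close>
  define \<eta> where "\<eta> = min e 1"
  have \<eta>: "0 < \<eta>" "\<eta> < 2 * pi" "\<eta> \<le> e" using e pi_gt3 by (auto simp: \<eta>_def)
  obtain \<epsilon> where \<epsilon>: "\<epsilon> > 0" and trap: "\<And>C v. connected C \<Longrightarrow> C \<subseteq> UNIV \<Longrightarrow> 0 \<in> C \<Longrightarrow>
      (\<And>w. w \<in> C \<Longrightarrow> norm (exp w - 1 :: complex) < \<epsilon>) \<Longrightarrow> v \<in> C \<Longrightarrow> norm v < \<eta>"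
    by (rule connected_within_ball[of UNIV exp \<eta>]) (use exp_neq_1 \<eta> in \<open>auto intro!: continuous_intros\<close>)
  define T where "T = \<bar>t\<bar>"
  have T: "0 \<in> {-T..T}" "t \<in> {-T..T}" by (auto simp: T_def)
  \<comment> \<open>The minimum of the modulus of \<open>\<omega>\<close> on the interval is
    positive and bounds the denominators below.\<close>
  have "{-T..T} \<noteq> {}" using T by blast
  then obtain s0 where s0: "s0 \<in> {-T..T}" "\<And>s. s \<in> {-T..T} \<Longrightarrow> norm (\<omega> s0) \<le> norm (\<omega> s)"
    using continuous_attains_inf[OF compact_Icc _ continuous_on_norm[OF is_cf_continuous[OF cf]]]
    by blast
  have c: "norm (\<omega> s0) > 0" using infinitely_divisible_cf_nonzero[OF \<omega>] by simp
  have "eventually (\<lambda>n. \<forall>s\<in>{-T..T}. dist (exp (l n s)) (\<omega> s) < \<epsilon> * norm (\<omega> s0)) sequentially"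
    using \<epsilon> c by (intro uniform_limitD[OF u]) simp
  thus "eventually (\<lambda>n. dist (l n t) (cf_log \<omega> t) < e) sequentially"
  proof eventually_elim
    case (elim n)
    let ?D = "\<lambda>s. l n s - cf_log \<omega> s"
    have "norm (?D t) < \<eta>"
    proof (rule trap)
      show "connected (?D ` {-T..T})"
        by (intro connected_continuous_image continuous_intros continuous_on_subset[OF l(1)]
            continuous_on_subset[OF L(1)]) auto
      show "0 \<in> ?D ` {-T..T}" using T(1) l(2) L(2) by (intro image_eqI[of _ _ 0]) auto
      show "?D t \<in> ?D ` {-T..T}" using T by simp
      fix w assume "w \<in> ?D ` {-T..T}"
      then obtain s where s: "s \<in> {-T..T}" "w = ?D s" by auto
      have nz: "\<omega> s \<noteq> 0" by (rule infinitely_divisible_cf_nonzero[OF \<omega>])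
      have "exp w - 1 = (exp (l n s) - \<omega> s) / \<omega> s"
        using nz by (simp add: s exp_diff L field_simps)
      hence "norm (exp w - 1) = norm (exp (l n s) - \<omega> s) / norm (\<omega> s)"
        by (simp add: norm_divide)
      also have "\<dots> \<le> norm (exp (l n s) - \<omega> s) / norm (\<omega> s0)"
        using s0(2)[OF s(1)] c nz by (intro divide_left_mono mult_pos_pos) auto
      also have "\<dots> < \<epsilon>" using elim s(1) c by (simp add: dist_norm field_simps)
      finally show "norm (exp w - 1) < \<epsilon>" .
    qed simp
    thus ?case using \<eta> by (simp add: dist_norm)
  qed
qed

section \<open>Tightness from characteristic functions near 0\<close>

lemma (in real_distribution) exists_prob_tail_less:
  assumes "e > 0"
  obtains K where "K > 0" "prob {x. \<bar>x\<bar> > K} < e"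
proof -
  have "(\<lambda>n. prob {x. \<bar>x\<bar> > real n}) \<longlonglongrightarrow> prob (\<Inter>n. {x. \<bar>x\<bar> > real n})"
    by (rule finite_Lim_measure_decseq) (auto simp: decseq_def)
  also have "(\<Inter>n. {x::real. \<bar>x\<bar> > real n}) = {}"
    by (auto simp: set_eq_iff not_less intro: real_arch_simple)
  finally have "(\<lambda>n. prob {x. \<bar>x\<bar> > real n}) \<longlonglongrightarrow> 0" by simp
  hence "eventually (\<lambda>n. prob {x. \<bar>x\<bar> > real n} < e \<and> n > 0) sequentially"
    using assms eventually_gt_at_top[of 0] by (auto intro!: eventually_conj dest: order_tendstoD(2))
  then obtain n where "prob {x. \<bar>x\<bar> > real n} < e" "n > 0"
    by (auto simp: eventually_sequentially)
  thus ?thesis by (intro that[of "real n"]) auto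
qed

text \<open>Averaging \<open>1 - char \<mu> (\<sigma> t)\<close> over a standard normal \<open>t\<close> gives the \<open>\<mu>\<close>-integral of
  \<open>1 - exp (- (\<sigma> x)\<^sup>2 / 2)\<close>, which is at least \<open>1/3\<close> for \<open>|x| \<ge> 1 / \<sigma>\<close>.\<close>

lemma (in real_distribution) prob_tail_le_char:
  assumes \<sigma>: "\<sigma> > 0" and \<epsilon>: "\<epsilon> \<ge> 0"
    and char_le: "\<And>t. \<bar>t\<bar> \<le> \<sigma> * K \<Longrightarrow> norm (1 - char M t) \<le> \<epsilon>"
  shows "prob {x. \<bar>x\<bar> \<ge> 1 / \<sigma>} \<le> 3 * (\<epsilon> + 2 * measure std_normal_distribution {t. \<bar>t\<bar> > K})"
proof -
  interpret G: real_distribution std_normal_distribution by (rule real_dist_normal_dist)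
  interpret P: pair_prob_space std_normal_distribution M ..
  have int: "integrable (std_normal_distribution \<Otimes>\<^sub>M M) (\<lambda>(t, x). iexp (\<sigma> * t * x))"
    by (rule P.integrable_const_bound[where B = 1]) (auto simp: split_beta')
  have eq: "(CLINT t|std_normal_distribution. char M (\<sigma> * t)) =
      (CLINT x|M. char std_normal_distribution (\<sigma> * x))"
  proof -
    have "(CLINT x|M. CLINT t|std_normal_distribution. iexp (\<sigma> * t * x)) =
        (CLINT t|std_normal_distribution. CLINT x|M. iexp (\<sigma> * t * x))"
      using P.Fubini_integral[OF int] by simp
    moreover have "\<sigma> * t * x = \<sigma> * x * t" for t x by simp
    ultimately show ?thesis unfolding char_def by simp
  qed
  have [simp]: "integrable std_normal_distribution (\<lambda>t. char M (\<sigma> * t))"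
    by (rule G.integrable_const_bound[where B = 1]) (auto simp: cmod_char_le_1)
  have [simp]: "integrable M (\<lambda>x. exp (- ((\<sigma> * x)\<^sup>2 / 2)))"
    by (rule integrable_const_bound[where B = 1]) auto
  have [simp]: "prob UNIV = 1" "G.prob UNIV = 1" using prob_space G.prob_space by simp_all
  have avg: "(LINT t|std_normal_distribution. 1 - Re (char M (\<sigma> * t))) =
      (LINT x|M. 1 - exp (- (\<sigma> * x)\<^sup>2 / 2))"
  proof -
    have "(LINT t|std_normal_distribution. 1 - Re (char M (\<sigma> * t))) =
        1 - Re (CLINT t|std_normal_distribution. char M (\<sigma> * t))"
      by simp
    also have "\<dots> = 1 - Re (CLINT x|M. of_real (exp (- (\<sigma> * x)\<^sup>2 / 2)))"
      unfolding eq char_std_normal_distribution ..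
    also have "\<dots> = (LINT x|M. 1 - exp (- (\<sigma> * x)\<^sup>2 / 2))"
      unfolding integral_complex_of_real by simp
    finally show ?thesis .
  qed
  \<comment> \<open>From \<open>exp (1/2) \<ge> 3/2\<close>; this leaves the lower bound 1/3 on the
    tail, and the factor 3 in the conclusion is its inverse.\<close>
  have third: "exp (- 1 / 2 :: real) \<le> 2 / 3"
  proof -
    have "(3 / 2 :: real) \<le> exp (1 / 2)" using exp_ge_add_one_self[of "1/2 :: real"] by simp
    thus ?thesis by (simp add: exp_minus field_simps)
  qed
  have "1 / 3 * prob {x. \<bar>x\<bar> \<ge> 1 / \<sigma>} = (LINT x|M. 1 / 3 * indicator {x. \<bar>x\<bar> \<ge> 1 / \<sigma>} x)"
    by simp
  also have "\<dots> \<le> (LINT x|M. 1 - exp (- (\<sigma> * x)\<^sup>2 / 2))"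
  proof (rule integral_mono)
    show "1 / 3 * indicator {x. \<bar>x\<bar> \<ge> 1 / \<sigma>} x \<le> 1 - exp (- (\<sigma> * x)\<^sup>2 / 2)" for x
    proof (cases "\<bar>x\<bar> \<ge> 1 / \<sigma>")
      case True
      hence "1 \<le> \<sigma> * \<bar>x\<bar>" using \<sigma> by (simp add: field_simps)
      hence "1 \<le> (\<sigma> * x)\<^sup>2"
        using \<sigma> by (metis abs_mult abs_of_pos one_le_power power2_abs)
      hence "exp (- (\<sigma> * x)\<^sup>2 / 2) \<le> exp (- 1 / 2)" by simp
      hence "exp (- (\<sigma> * x)\<^sup>2 / 2) \<le> 2 / 3" using third by (rule order_trans)
      thus ?thesis using True by simp
    qed simp
  qed (auto intro!: integrable_const_bound[where B = 1] split: split_indicator)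
  also have "\<dots> = (LINT t|std_normal_distribution. 1 - Re (char M (\<sigma> * t)))" using avg by simp
  \<comment> \<open>Up to \<open>K\<close> the point \<open>\<sigma> * t\<close> lies where
    \<open>char_le\<close> speaks; beyond \<open>K\<close> the trivial bound 2 is charged to the
    Gaussian tail.\<close>
  also have "\<dots> \<le> (LINT t|std_normal_distribution. \<epsilon> + 2 * indicator {t. \<bar>t\<bar> > K} t)"
  proof (rule integral_mono)
    show "1 - Re (char M (\<sigma> * t)) \<le> \<epsilon> + 2 * indicator {t. \<bar>t\<bar> > K} t" for t
    proof (cases "\<bar>t\<bar> > K")
      case True
      have "- Re (char M (\<sigma> * t)) \<le> 1"
        using abs_Re_le_cmod[of "char M (\<sigma> * t)"] cmod_char_le_1[of "\<sigma> * t"] by linarith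
      thus ?thesis using True \<epsilon> by simp
    next
      case False
      hence "\<bar>\<sigma> * t\<bar> \<le> \<sigma> * K" using \<sigma> by (simp add: abs_mult)
      thus ?thesis using char_le[of "\<sigma> * t"] complex_Re_le_cmod[of "1 - char M (\<sigma> * t)"] False
        by simp
    qed
  qed (auto intro!: G.integrable_const_bound[where B = "\<epsilon> + 2"] simp: \<epsilon> split: split_indicator)
  also have "\<dots> = \<epsilon> + 2 * G.prob {t. \<bar>t\<bar> > K}"
    by (subst Bochner_Integration.integral_add)
       (auto intro!: G.integrable_const_bound[where B = 1] split: split_indicator)
  finally show ?thesis by simp
qed

text \<open>With scale \<open>d / K\<close> the tail estimate consults the characteristic functions
  only for |t| \<le> d, and the radius \<open>K / d\<close> is common to all
  \<open>n\<close>.\<close>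

lemma tight_if_equicontinuous_char:
  assumes \<mu>: "\<And>n. real_distribution (\<mu> n)"
    and equi: "\<And>e. e > 0 \<Longrightarrow> \<exists>d>0. \<forall>n t. \<bar>t\<bar> \<le> d \<longrightarrow> norm (1 - char (\<mu> n) t) \<le> e"
  shows "tight \<mu>"
  unfolding tight_def
proof (intro conjI allI impI \<mu>)
  fix e :: real assume e: "e > 0"
  interpret G: real_distribution std_normal_distribution by (rule real_dist_normal_dist)
  \<comment> \<open>With 1/12 here and for \<open>d\<close>, the tail is at most 3 (e/12 + 2 e/12) =
    3 e/4, which is below \<open>e\<close>.\<close>
  obtain K where K: "K > 0" "G.prob {t. \<bar>t\<bar> > K} < e / 12"
    using G.exists_prob_tail_less[of "e / 12"] e by auto
  obtain d where d: "d > 0" "\<And>n t. \<bar>t\<bar> \<le> d \<Longrightarrow> norm (1 - char (\<mu> n) t) \<le> e / 12"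
    using equi[of "e / 12"] e by auto
  let ?b = "K / d"
  show "\<exists>a b. a < b \<and> (\<forall>n. 1 - e < measure (\<mu> n) {a<..b})"
  proof (rule exI[of _ "- ?b"], rule exI[of _ ?b], intro conjI allI)
    show "- ?b < ?b" using d K by simp
    fix n
    interpret M: real_distribution "\<mu> n" by (rule \<mu>)
    have "M.prob {x. \<bar>x\<bar> \<ge> 1 / (d / K)} \<le> 3 * (e / 12 + 2 * G.prob {t. \<bar>t\<bar> > K})"
      using d K e by (intro M.prob_tail_le_char) auto
    also have "\<dots> < e" using K(2) e by simp
    finally have 1: "M.prob {x. \<bar>x\<bar> \<ge> ?b} < e" by simp
    have "1 - M.prob {x. \<bar>x\<bar> \<ge> ?b} = M.prob (UNIV - {x. \<bar>x\<bar> \<ge> ?b})"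
      using M.prob_compl[of "{x. \<bar>x\<bar> \<ge> ?b}"] by simp
    also have "\<dots> \<le> M.prob {- ?b<..?b}"
      by (rule M.finite_measure_mono) auto
    finally show "1 - e < M.prob {- ?b<..?b}" using 1 by simp
  qed
qed

section \<open>Random sums and their generating functions\<close>

text \<open>Conditioning on the value of \<open>N\<close>: the n-th partial sum integrates
  \<open>f\<close> over \<open>N < n\<close> and is dominated by the norm of
  \<open>f\<close>.\<close>

lemma integral_sums_fibres:
  fixes f :: "'a \<Rightarrow> complex" and N :: "'a \<Rightarrow> nat"
  assumes [measurable]: "N \<in> measurable M (count_space UNIV)" and f: "integrable M f"
  shows "(\<lambda>n. CLINT x|M. indicator {n} (N x) * f x) sums (CLINT x|M. f x)"
  unfolding sums_def
proof -
  have [measurable]: "f \<in> borel_measurable M" using f by auto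
  have [measurable]: "(\<lambda>x. indicator {n} (N x) :: complex) \<in> borel_measurable M" for n
    by (rule measurable_compose[OF assms(1)]) simp
  have int: "integrable M (\<lambda>x. indicator {n} (N x) * f x)" for n
    by (rule Bochner_Integration.integrable_bound[OF f]) (auto split: split_indicator)
  have part: "(\<Sum>i<n. indicator {i} (N x) * f x) = (if N x < n then f x else 0)" for n x
  proof -
    have "(\<Sum>i<n. indicator {i} (N x) * f x) = (\<Sum>i<n. if N x = i then f x else 0)"
      by (intro sum.cong) auto
    thus ?thesis by simp
  qed
  have "(\<lambda>n. CLINT x|M. (if N x < n then f x else 0)) \<longlonglongrightarrow> (CLINT x|M. f x)"
  proof (rule integral_dominated_convergence[where w = "\<lambda>x. norm (f x)"])
    show "AE x in M. (\<lambda>n. if N x < n then f x else 0) \<longlonglongrightarrow> f x"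
      by (intro AE_I2 tendsto_eventually eventually_mono[OF eventually_gt_at_top]) auto
  qed (use f in auto)
  thus "(\<lambda>n. \<Sum>i<n. CLINT x|M. indicator {i} (N x) * f x) \<longlonglongrightarrow> (CLINT x|M. f x)"
    by (simp add: part int flip: Bochner_Integration.integral_sum)
qed

lemma pgf_sums:
  assumes "prob_space M" and [measurable]: "N \<in> measurable M (count_space UNIV)" and s: "norm s \<le> 1"
  shows "(\<lambda>n. of_real (measure M {x\<in>space M. N x = n}) * s ^ n) sums pgf M N s"
proof -
  interpret prob_space M by fact
  have "integrable M (\<lambda>x. s ^ N x)"
    by (rule integrable_const_bound[where B = 1]) (auto simp: norm_power power_le_one s)
  hence "(\<lambda>n. CLINT x|M. indicator {n} (N x) * s ^ N x) sums pgf M N s"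
    unfolding pgf_def by (intro integral_sums_fibres) auto
  also have "(\<lambda>n. CLINT x|M. indicator {n} (N x) * s ^ N x) =
      (\<lambda>n. CLINT x|M. s ^ n * of_real (indicator {x\<in>space M. N x = n} x))"
    by (intro ext Bochner_Integration.integral_cong) (auto split: split_indicator)
  also have "\<dots> = (\<lambda>n. of_real (measure M {x\<in>space M. N x = n}) * s ^ n)"
    by (intro ext) (simp add: mult.commute)
  finally show ?thesis .
qed

lemma iid_with_index_measurable:
  assumes "iid_with_index M N X"
  shows "N \<in> measurable M (count_space UNIV)" "X i \<in> borel_measurable M"
proof -
  interpret prob_space M using assms unfolding iid_with_index_def by auto
  have ind: "indep_vars (\<lambda>_. borel) (case_nat (\<lambda>x. real (N x)) X) (UNIV :: nat set)"
    using assms unfolding iid_with_index_def by auto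
  have rv: "random_variable borel ((case_nat (\<lambda>x. real (N x)) X) i)" for i
    using ind unfolding indep_vars_def by auto
  show "X i \<in> borel_measurable M" using rv[of "Suc i"] by simp
  have [measurable]: "(\<lambda>x. real (N x)) \<in> borel_measurable M" using rv[of 0] by simp
  \<comment> \<open>Independence is stated for the real variable \<open>real (N x)\<close>; the
    floor brings back the natural number.\<close>
  have "(\<lambda>x. nat \<lfloor>real (N x)\<rfloor>) \<in> measurable M (count_space UNIV)" by measurable
  thus "N \<in> measurable M (count_space UNIV)" by simp
qed

lemma real_distribution_sum_law:
  assumes "iid_with_index M N X"
  shows "real_distribution (sum_law M N X)"
proof -
  interpret prob_space M using assms unfolding iid_with_index_def by auto
  note [measurable] = iid_with_index_measurable[OF assms]
  have "(\<lambda>x. \<Sum>i<N x. X i x) \<in> borel_measurable M" by measurable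
  thus ?thesis unfolding sum_law_def by (rule real_distribution_distr)
qed

text \<open>On \<open>N = n\<close> the exponential of the sum is a product of \<open>n\<close>
  factors; joint independence splits off \<open>P (N = n)\<close> and one factor \<open>h\<close>
  per summand, and summing over \<open>n\<close> is the generating function series.\<close>

lemma char_sum_law:
  assumes iid: "iid_with_index M N X"
  shows "char (sum_law M N X) t = pgf M N (char (distr M borel (X 0)) t)"
proof -
  have M: "prob_space M" using iid unfolding iid_with_index_def by auto
  interpret prob_space M by fact
  note [measurable] = iid_with_index_measurable[OF iid]
  define V where "V = case_nat (\<lambda>x. real (N x)) X"
  have ind: "indep_vars (\<lambda>_. borel) V (UNIV :: nat set)"
    and id: "\<And>i. distr M borel (X i) = distr M borel (X 0)"
    using iid unfolding iid_with_index_def V_def by auto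
  have S[measurable]: "(\<lambda>x. \<Sum>i<N x. X i x) \<in> borel_measurable M" by measurable
  define h where "h = char (distr M borel (X 0)) t"
  have h: "norm h \<le> 1" unfolding h_def
    by (intro real_distribution.cmod_char_le_1 real_distribution_distr) measurable
  have hX: "(CLINT x|M. iexp (t * X i x)) = h" for i
    unfolding h_def id[of i, symmetric] char_def by (subst integral_distr) auto
  have summand: "(CLINT x|M. indicator {n} (N x) * iexp (t * (\<Sum>i<N x. X i x))) =
      of_real (measure M {x\<in>space M. N x = n}) * h ^ n" for n
  proof -
    \<comment> \<open>Position 0 of the family is \<open>N\<close>, so the event
      \<open>N = n\<close> becomes one more factor and the product runs over \<open>Suc n\<close>
      positions.\<close>
    define Y :: "nat \<Rightarrow> real \<Rightarrow> complex"
      where "Y = case_nat (indicator {real n}) (\<lambda>_ y. iexp (t * y))"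
    have "indep_vars (\<lambda>_. borel) (\<lambda>i x. Y i (V i x)) (UNIV :: nat set)"
      by (rule indep_vars_compose2[OF ind]) (auto simp: Y_def split: nat.split)
    hence indY: "indep_vars (\<lambda>_. borel) (\<lambda>i x. Y i (V i x)) {..<Suc n}"
      by (rule indep_vars_subset) auto
    have [measurable]: "V i \<in> borel_measurable M" for i
      using ind unfolding indep_vars_def by auto
    have [measurable]: "Y i \<in> borel_measurable borel" for i
      by (cases i) (auto simp: Y_def)
    have "(CLINT x|M. indicator {n} (N x) * iexp (t * (\<Sum>i<N x. X i x))) =
        (CLINT x|M. (\<Prod>i<Suc n. Y i (V i x)))"
    proof (intro Bochner_Integration.integral_cong refl)
      fix x
      have "(\<Prod>i<Suc n. Y i (V i x)) = indicator {n} (N x) * (\<Prod>i<n. iexp (t * X i x))"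
        unfolding prod.lessThan_Suc_shift by (simp add: Y_def V_def indicator_def)
      also have "(\<Prod>i<n. iexp (t * X i x)) = iexp (t * (\<Sum>i<n. X i x))"
        by (simp add: sum_distrib_left flip: exp_sum)
      finally show "indicator {n} (N x) * iexp (t * (\<Sum>i<N x. X i x)) = (\<Prod>i<Suc n. Y i (V i x))"
        by (auto split: split_indicator)
    qed
    also have "\<dots> = (\<Prod>i<Suc n. CLINT x|M. Y i (V i x))"
    proof (rule indep_vars_lebesgue_integral)
      show "integrable M (\<lambda>x. Y i (V i x))" for i
        by (rule integrable_const_bound[where B = 1])
           (auto simp: Y_def split: nat.split split_indicator)
    qed (use indY in auto)
    also have "\<dots> = (CLINT x|M. indicator {real n} (real (N x))) * (\<Prod>i<n. CLINT x|M. iexp (t * X i x))"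
      unfolding prod.lessThan_Suc_shift by (simp add: Y_def V_def)
    also have "(\<Prod>i<n. CLINT x|M. iexp (t * X i x)) = h ^ n" unfolding hX by simp
    also have "(CLINT x|M. indicator {real n} (real (N x))) =
        (CLINT x|M. of_real (indicator {x\<in>space M. N x = n} x))"
      by (intro Bochner_Integration.integral_cong) (auto split: split_indicator)
    also have "\<dots> = of_real (measure M {x\<in>space M. N x = n})" by simp
    finally show ?thesis .
  qed
  have "(\<lambda>n. CLINT x|M. indicator {n} (N x) * iexp (t * (\<Sum>i<N x. X i x))) sums
      (CLINT x|M. iexp (t * (\<Sum>i<N x. X i x)))"
    by (intro integral_sums_fibres integrable_iexp) auto
  moreover have "(CLINT x|M. iexp (t * (\<Sum>i<N x. X i x))) = char (sum_law M N X) t"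
    unfolding char_def sum_law_def by (subst integral_distr) auto
  ultimately have "(\<lambda>n. of_real (measure M {x\<in>space M. N x = n}) * h ^ n) sums char (sum_law M N X) t"
    by (simp only: summand)
  from sums_unique2[OF this pgf_sums[OF M _ h]] show ?thesis
    unfolding h_def by measurable
qed

text \<open>Identity theorem: the difference is a power series whose zeros accumulate at 0, so all
  coefficients vanish. A PGF prescribed on (0,1) is thus determined on the closed disc, where
  characteristic functions take their values.\<close>

lemma pgf_eq_if_eq_on_real:
  assumes M: "prob_space M" and N: "N \<in> measurable M (count_space UNIV)"
    and M': "prob_space M'" and N': "N' \<in> measurable M' (count_space UNIV)"
    and eq: "\<And>s::real. 0 < s \<Longrightarrow> s < 1 \<Longrightarrow> pgf M N (of_real s) = pgf M' N' (of_real s)"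
    and s: "norm s \<le> 1"
  shows "pgf M N s = pgf M' N' s"
proof -
  define a :: "nat \<Rightarrow> complex" where "a n = of_real (measure M {x\<in>space M. N x = n}) -
    of_real (measure M' {x\<in>space M'. N' x = n})" for n
  \<comment> \<open>The factor \<open>z\<close> gives \<open>F 0 = 0\<close> and moves
    \<open>a n\<close> to the positive index \<open>Suc n\<close>, the form required for isolating
    the zero at 0.\<close>
  define F where "F z = z * (pgf M N z - pgf M' N' z)" for z
  have a_sums: "(\<lambda>n. a n * z ^ n) sums (pgf M N z - pgf M' N' z)" if "norm z \<le> 1" for z
    unfolding a_def left_diff_distrib by (intro sums_diff pgf_sums assms that)
  define b where "b = case_nat 0 a"
  have b_sums: "(\<lambda>n. b n * z ^ n) sums F z" if z: "norm z \<le> 1" for z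
  proof -
    have "(\<lambda>n. z * (a n * z ^ n)) sums F z" unfolding F_def by (intro sums_mult a_sums z)
    hence "(\<lambda>n. b (Suc n) * z ^ Suc n) sums F z" by (simp add: b_def mult_ac)
    thus ?thesis using sums_Suc[of "\<lambda>n. b n * z ^ n"] by (simp add: b_def)
  qed
  have "a n = 0" for n
  proof (rule ccontr)
    assume "a n \<noteq> 0"
    then obtain r where r: "r > 0" "\<And>z. z \<in> cball 0 r - {0} \<Longrightarrow> F z \<noteq> 0"
      using powser_0_nonzero[of 1 0 b F "Suc n"] b_sums by (auto simp: b_def F_def)
    define x where "x = min r (1/2)"
    have x: "0 < x" "x < 1" "x \<le> r" using r(1) by (auto simp: x_def)
    have "F (of_real x) \<noteq> 0" using x by (intro r) auto
    thus False using eq[OF x(1,2)] by (simp add: F_def)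
  qed
  hence "(\<lambda>n. 0) sums (pgf M N s - pgf M' N' s)" using a_sums[OF s] by simp
  thus ?thesis using sums_unique2[OF _ sums_zero] by fastforce
qed

text \<open>The space is the product of \<open>p\<close> with countably many copies of
  \<open>\<mu>\<close>, and the variables are its coordinates.\<close>

lemma ex_iid_with_index:
  fixes p :: "nat pmf"
  assumes \<mu>: "real_distribution \<mu>"
  obtains M :: "(nat \<times> (nat \<Rightarrow> real)) measure" and N X where
    "iid_with_index M N X" "distr M borel (X 0) = \<mu>" "\<And>s. pgf M N s = pgf (measure_pmf p) id s"
proof -
  interpret \<mu>: real_distribution \<mu> by (rule \<mu>)
  let ?S = "PiM UNIV (\<lambda>_::nat. \<mu>)"
  interpret S: product_prob_space "\<lambda>_::nat. \<mu>" UNIV ..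
  have S: "prob_space ?S" by (intro prob_space_PiM \<mu>.prob_space_axioms)
  interpret P: pair_prob_space "measure_pmf p" ?S ..
  define M where "M = measure_pmf p \<Otimes>\<^sub>M ?S"
  have times: "emeasure M (B \<times> F) = emeasure (measure_pmf p) B * emeasure ?S F"
    if "F \<in> sets ?S" for B F
    unfolding M_def using that S
    by (intro sigma_finite_measure.emeasure_pair_measure_Times prob_space_imp_sigma_finite) auto
  define N :: "nat \<times> (nat \<Rightarrow> real) \<Rightarrow> nat" where "N = fst"
  define X :: "nat \<Rightarrow> nat \<times> (nat \<Rightarrow> real) \<Rightarrow> real" where "X i = (\<lambda>x. snd x i)" for i
  define V where "V = case_nat (\<lambda>x. real (N x)) X"
  interpret M: prob_space M unfolding M_def by (rule P.prob_space_axioms)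
  have [measurable]: "N \<in> measurable M (count_space UNIV)"
  proof -
    have "fst \<in> measurable M (measure_pmf p)" unfolding M_def by (rule measurable_fst)
    thus ?thesis unfolding N_def by simp
  qed
  have [measurable]: "X i \<in> borel_measurable M" for i
    unfolding X_def M_def by measurable
  have V_meas[measurable]: "V i \<in> borel_measurable M" for i
    unfolding V_def by (cases i) simp_all
  have distrX: "distr M borel (X i) = \<mu>" for i
  proof (rule measure_eqI)
    fix A assume "A \<in> sets (distr M borel (X i))"
    hence A: "A \<in> sets \<mu>" by simp
    have "X i -` A \<inter> space M = UNIV \<times> {f \<in> space ?S. f i \<in> A}"
      by (auto simp: X_def M_def space_pair_measure)
    moreover have "emeasure ?S {f \<in> space ?S. f i \<in> A} = emeasure \<mu> A"
      by (rule S.emeasure_PiM_Collect_single) (use A in auto)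
    moreover have "{f \<in> space ?S. f i \<in> A} \<in> sets ?S" using A by measurable
    ultimately show "emeasure (distr M borel (X i)) A = emeasure \<mu> A"
      using A by (simp add: emeasure_distr times
          measure_pmf.emeasure_space_1[simplified])
  qed simp
  let ?\<nu> = "\<lambda>i. distr M borel (V i)"
  interpret \<nu>: product_prob_space ?\<nu> UNIV
    by (intro product_prob_spaceI M.prob_space_distr V_meas)
  \<comment> \<open>Joint independence means that the joint law is the product of the marginals; it
    suffices to compare them on cylinders over a finite \<open>J\<close>.\<close>
  have "distr M (PiM UNIV (\<lambda>_. borel)) (\<lambda>x. \<lambda>i\<in>UNIV. V i x) = PiM UNIV ?\<nu>" (is "?D = _")
  proof (rule \<nu>.PiM_eq)
    show "sets ?D = sets (PiM UNIV ?\<nu>)" by (simp cong: sets_PiM_cong)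
    fix J :: "nat set" and E assume J: "finite J" "\<And>j. j \<in> J \<Longrightarrow> E j \<in> sets (?\<nu> j)"
    hence E[measurable]: "\<And>j. j \<in> J \<Longrightarrow> E j \<in> sets borel" by simp
    let ?X = "prod_emb UNIV ?\<nu> J (\<Pi>\<^sub>E j\<in>J. E j)"
    \<comment> \<open>A cylinder factors into a condition \<open>B\<close> on \<open>N\<close>, void
      unless 0 is in \<open>J\<close>, and a cylinder over the remaining indices, shifted down by
      one.\<close>
    define K where "K = Suc -` J"
    have K: "finite K" unfolding K_def using J(1) by (rule finite_vimageI) simp
    define B where "B = (if 0 \<in> J then real -` E 0 else UNIV)"
    let ?F = "prod_emb UNIV (\<lambda>_. \<mu>) K (\<Pi>\<^sub>E j\<in>K. E (Suc j))"
    have mem: "(\<forall>j\<in>J. Q j) \<longleftrightarrow> (0 \<in> J \<longrightarrow> Q 0) \<and> (\<forall>j\<in>K. Q (Suc j))" for Q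
    proof
      assume R: "(0 \<in> J \<longrightarrow> Q 0) \<and> (\<forall>j\<in>K. Q (Suc j))"
      show "\<forall>j\<in>J. Q j"
      proof
        fix j assume "j \<in> J" thus "Q j" using R by (cases j) (auto simp: K_def)
      qed
    qed (auto simp: K_def)
    have pre: "(\<lambda>x. \<lambda>i\<in>UNIV. V i x) -` ?X \<inter> space M = B \<times> ?F"
    proof -
      have "x \<in> (\<lambda>x. \<lambda>i\<in>UNIV. V i x) -` ?X \<inter> space M \<longleftrightarrow> (\<forall>j\<in>J. V j x \<in> E j)" for x
        by (auto simp: prod_emb_def PiE_iff M_def space_pair_measure space_PiM)
      moreover have "x \<in> B \<times> ?F \<longleftrightarrow> (0 \<in> J \<longrightarrow> V 0 x \<in> E 0) \<and> (\<forall>j\<in>K. V (Suc j) x \<in> E (Suc j))" for x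
        by (cases x) (auto simp: prod_emb_def PiE_iff B_def V_def X_def N_def space_PiM)
      ultimately show ?thesis unfolding mem by blast
    qed
    have Xs: "?X \<in> sets (PiM UNIV ?\<nu>)" using J by (intro sets_PiM_I) auto
    have F: "?F \<in> sets ?S" using K J(2) by (intro sets_PiM_I) (auto simp: K_def)
    have "emeasure ?D ?X = emeasure M (B \<times> ?F)"
      unfolding pre[symmetric]
    proof (rule emeasure_distr)
      show "?X \<in> sets (PiM UNIV (\<lambda>_. borel))" using Xs by (simp cong: sets_PiM_cong)
      show "(\<lambda>x. \<lambda>i\<in>UNIV. V i x) \<in> measurable M (PiM UNIV (\<lambda>_. borel))"
        by (intro measurable_restrict V_meas)
    qed
    also have "\<dots> = emeasure (measure_pmf p) B * emeasure ?S ?F"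
      using F by (rule times)
    also have "emeasure ?S ?F = (\<Prod>j\<in>K. emeasure \<mu> (E (Suc j)))"
      using K J(2) by (intro emeasure_PiM_emb) (auto simp: K_def \<mu>.prob_space_axioms)
    also have "\<dots> = (\<Prod>j\<in>K. emeasure (?\<nu> (Suc j)) (E (Suc j)))"
      by (simp add: V_def distrX)
    also have "\<dots> = (\<Prod>j\<in>J - {0}. emeasure (?\<nu> j) (E j))"
    proof -
      have "J - {0} = Suc ` K" unfolding K_def by (auto simp: image_iff gr0_conv_Suc)
      thus ?thesis by (simp add: prod.reindex)
    qed
    also have "emeasure (measure_pmf p) B = (if 0 \<in> J then emeasure (?\<nu> 0) (E 0) else 1)"
    proof (cases "0 \<in> J")
      case True
      have "emeasure (?\<nu> 0) (E 0) = emeasure M (B \<times> space ?S)"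
        using True J(2) by (subst emeasure_distr)
          (auto simp: V_def N_def B_def M_def space_pair_measure intro!: arg_cong2[of _ _ _ _ emeasure])
      also have "\<dots> = emeasure (measure_pmf p) B"
        by (simp add: times prob_space.emeasure_space_1[OF S])
      finally show ?thesis using True by simp
    qed (simp add: B_def measure_pmf.emeasure_space_1[simplified])
    also have "\<dots> * (\<Prod>j\<in>J - {0}. emeasure (?\<nu> j) (E j)) = (\<Prod>j\<in>J. emeasure (?\<nu> j) (E j))"
      using J(1) by (auto simp: prod.remove)
    finally show "emeasure ?D ?X = (\<Prod>j\<in>J. emeasure (?\<nu> j) (E j))" .
  qed
  hence "M.indep_vars (\<lambda>_. borel) V UNIV"
    by (subst M.indep_vars_iff_distr_eq_PiM) auto
  hence "iid_with_index M N X"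
    unfolding iid_with_index_def V_def using distrX M.prob_space_axioms by simp
  moreover have "pgf M N s = pgf (measure_pmf p) id s" for s
  proof -
    have "distr M (measure_pmf p) fst = measure_pmf p"
      unfolding M_def using S by (rule prob_space.distr_pair_fst)
    hence "pgf (measure_pmf p) id s = (CLINT n|distr M (measure_pmf p) fst. s ^ n)"
      unfolding pgf_def by simp
    also have "\<dots> = pgf M N s"
      unfolding pgf_def N_def by (subst integral_distr) (auto simp: M_def)
    finally show ?thesis by simp
  qed
  ultimately show ?thesis using that distrX by blast
qed

section \<open>Laplace transforms and mixed Poisson laws\<close>

lemma norm_exp_neg_mult_le_1:
  assumes "Re v \<ge> 0" "z > 0"
  shows "norm (exp (- v * of_real z)) \<le> 1"
  using assms by simp

lemma integrable_laplace:
  assumes "prob_space M" and [measurable]: "Z \<in> borel_measurable M"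
    and pos: "AE x in M. Z x > 0" and v: "Re v \<ge> 0"
  shows "integrable M (\<lambda>x. exp (- v * of_real (Z x)))"
proof -
  interpret prob_space M by fact
  show ?thesis
  proof (rule integrable_const_bound[where B = 1])
    show "AE x in M. norm (exp (- v * of_real (Z x))) \<le> 1"
      using pos by eventually_elim (rule norm_exp_neg_mult_le_1[OF v])
  qed measurable
qed

lemma continuous_on_laplace_transform:
  assumes "prob_space M" and [measurable]: "Z \<in> borel_measurable M"
    and pos: "AE x in M. Z x > 0"
  shows "continuous_on {v. Re v \<ge> 0} (laplace_transform M Z)"
  unfolding continuous_on_sequentially
proof (intro allI ballI impI)
  interpret prob_space M by fact
  fix vs v assume v: "v \<in> {v. Re v \<ge> 0}" and vs: "(\<forall>n::nat. vs n \<in> {v. Re v \<ge> 0}) \<and> vs \<longlonglongrightarrow> v"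
  show "(laplace_transform M Z \<circ> vs) \<longlonglongrightarrow> laplace_transform M Z v"
    unfolding laplace_transform_def comp_def
  proof (rule integral_dominated_convergence[where w = "\<lambda>_. 1"])
    show "AE x in M. (\<lambda>n. exp (- vs n * of_real (Z x))) \<longlonglongrightarrow> exp (- v * of_real (Z x))"
      using vs by (intro AE_I2 tendsto_intros) auto
    show "AE x in M. norm (exp (- vs n * of_real (Z x))) \<le> 1" for n
      using pos by eventually_elim (use vs in \<open>intro norm_exp_neg_mult_le_1, auto\<close>)
  qed auto
qed

text \<open>The modulus at \<open>v\<close> is at most \<open>E (exp (- n Z))\<close> once Re v
  \<ge> n, and this tends to 0 because \<open>Z > 0\<close>. A lower bound on the transform
  therefore bounds the real part of its argument.\<close>

lemma laplace_transform_Re_bounded: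
  assumes "prob_space M" and [measurable]: "Z \<in> borel_measurable M"
    and pos: "AE x in M. Z x > 0"
  obtains C where "\<And>v. Re v \<ge> 0 \<Longrightarrow> norm (laplace_transform M Z v) \<ge> 1 / 2 \<Longrightarrow> Re v \<le> C"
proof -
  interpret prob_space M by fact
  have "(\<lambda>n. LINT x|M. exp (- (real n * Z x))) \<longlonglongrightarrow> (LINT x|M. 0)"
  proof (rule integral_dominated_convergence[where w = "\<lambda>_. 1"])
    show "AE x in M. (\<lambda>n. exp (- (real n * Z x))) \<longlonglongrightarrow> 0"
      using pos
    proof eventually_elim
      case (elim x)
      have "exp (- (real n * Z x)) = exp (- Z x) ^ n" for n
        by (simp add: exp_of_nat_mult[symmetric])
      thus ?case using elim by (simp add: LIMSEQ_power_zero)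
    qed
    show "AE x in M. norm (exp (- (real n * Z x))) \<le> 1" for n
      using pos by eventually_elim simp
  qed auto
  hence "eventually (\<lambda>n. (LINT x|M. exp (- (real n * Z x))) < 1 / 2) sequentially"
    by (intro order_tendstoD) auto
  then obtain n :: nat where n: "(LINT x|M. exp (- (real n * Z x))) < 1 / 2"
    by (auto simp: eventually_sequentially)
  show ?thesis
  proof (rule that)
    fix v assume v: "Re v \<ge> 0" "norm (laplace_transform M Z v) \<ge> 1 / 2"
    show "Re v \<le> real n"
    proof (rule ccontr)
      assume *: "\<not> Re v \<le> real n"
      have "norm (laplace_transform M Z v) \<le> (LINT x|M. norm (exp (- v * of_real (Z x))))"
        unfolding laplace_transform_def by (rule integral_norm_bound)
      also have "\<dots> \<le> (LINT x|M. exp (- (real n * Z x)))"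
      proof (rule integral_mono_AE)
        show "integrable M (\<lambda>x. norm (exp (- v * of_real (Z x))))"
          by (intro integrable_norm integrable_laplace assms v)
        show "integrable M (\<lambda>x. exp (- (real n * Z x)))"
        proof (rule integrable_const_bound[where B = 1])
          show "AE x in M. norm (exp (- (real n * Z x))) \<le> 1" using pos by eventually_elim simp
        qed measurable
        show "AE x in M. norm (exp (- v * of_real (Z x))) \<le> exp (- (real n * Z x))"
          using pos by eventually_elim (use * in \<open>simp add: mult_right_mono\<close>)
      qed
      finally show False using n v by simp
    qed
  qed
qed

text \<open>If \<open>E (exp (- v Z)) = 1\<close> with \<open>Re v \<ge> 0\<close>, then \<open>exp (- v Z) = 1\<close> almost surely, which forces
  \<open>|v| Z \<ge> 2 pi\<close> almost surely unless \<open>v = 0\<close>.\<close>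

lemma laplace_transform_neq_1:
  assumes "prob_space M" and [measurable]: "Z \<in> borel_measurable M"
    and pos: "AE x in M. Z x > 0"
  obtains \<eta> where "\<eta> > 0" "\<And>v. Re v \<ge> 0 \<Longrightarrow> 0 < norm v \<Longrightarrow> norm v < \<eta> \<Longrightarrow> laplace_transform M Z v \<noteq> 1"
proof -
  interpret prob_space M by fact
  \<comment> \<open>\<open>Z\<close> is finite, so it cannot almost surely exceed every natural
    number. For such a bound \<open>c\<close>, the radius 2 pi / c works: |v| Z \<ge> 2 pi would
    give \<open>Z > c\<close> almost surely.\<close>
  have "\<exists>n::nat. n > 0 \<and> \<not> (AE x in M. Z x \<ge> real n)"
  proof (rule ccontr)
    assume "\<not> (\<exists>n::nat. n > 0 \<and> \<not> (AE x in M. Z x \<ge> real n))"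
    hence *: "AE x in M. Z x \<ge> real (Suc n)" for n by blast
    have "AE x in M. \<forall>n. Z x \<ge> real (Suc n)"
      using * by (simp only: AE_all_countable) blast
    hence "AE x in M. False"
    proof eventually_elim
      case (elim x)
      obtain n where "Z x < real n" using reals_Archimedean2 by blast
      thus ?case using elim[rule_format, of n] by simp
    qed
    thus False by simp
  qed
  then obtain c :: nat where c: "c > 0" "\<not> (AE x in M. Z x \<ge> real c)" by auto
  show ?thesis
  proof (rule that)
    show "2 * pi / real c > 0" using c by simp
    fix v assume v: "Re v \<ge> 0" "0 < norm v" "norm v < 2 * pi / real c"
    show "laplace_transform M Z v \<noteq> 1"
    proof
      assume eq: "laplace_transform M Z v = 1"
      let ?e = "\<lambda>x. exp (- v * of_real (Z x))"
      have int: "integrable M ?e" by (intro integrable_laplace assms v)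
      have le: "AE x in M. norm (?e x) \<le> 1"
        using pos by eventually_elim (rule norm_exp_neg_mult_le_1[OF v(1)])
      have nonneg: "AE x in M. 0 \<le> 1 - Re (?e x)"
        using le
      proof eventually_elim
        case (elim x) thus ?case using complex_Re_le_cmod[of "?e x"] by linarith
      qed
      have int1: "integrable M (\<lambda>x. 1 - Re (?e x))"
        using int by (intro Bochner_Integration.integrable_diff integrable_Re) auto
      have "(LINT x|M. 1 - Re (?e x)) = 1 - Re (laplace_transform M Z v)"
        unfolding laplace_transform_def
        using int by (subst Bochner_Integration.integral_diff)
          (auto simp: prob_space integrable_Re simp del: Re_exp)
      hence "(LINT x|M. 1 - Re (?e x)) = 0" by (simp add: eq)
      hence zero: "AE x in M. 1 - Re (?e x) = 0"
        using integral_nonneg_eq_0_iff_AE[OF int1 nonneg] by simp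
      have "AE x in M. Z x \<ge> real c"
        using zero le pos
      proof eventually_elim
        case (elim x)
        have "(norm (1 - ?e x))\<^sup>2 \<le> 2 * (1 - Re (?e x))" by (rule norm_sq_one_minus_le[OF elim(2)])
        hence e1: "?e x = 1" using elim(1) by simp
        show ?case
        proof (rule ccontr)
          assume "\<not> Z x \<ge> real c"
          hence "norm v * Z x < (2 * pi / real c) * real c"
            using v elim(3) by (intro mult_strict_mono) auto
          hence "norm (- v * of_real (Z x)) < 2 * pi" using c elim(3) by (simp add: norm_mult)
          moreover have "0 < norm (- v * of_real (Z x))" using v elim(3) by (simp add: norm_mult)
          ultimately show False using exp_neq_1[OF refl] e1 by blast
        qed
      qed
      thus False using c by simp
    qed
  qed
qed

text \<open>Given \<open>Z\<close>, take a Poisson law of mean \<open>Z / \<theta>\<close>, with PGF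
  \<open>exp (- Z (1 - s) / \<theta>)\<close>; averaging over \<open>Z\<close> yields the Laplace
  transform.\<close>

lemma ex_mixed_poisson_pmf:
  assumes "prob_space M" and [measurable]: "Z \<in> borel_measurable M"
    and pos: "AE x in M. Z x > 0" and \<theta>: "\<theta> > 0"
  obtains p :: "nat pmf" where
    "\<And>s. norm s \<le> 1 \<Longrightarrow> pgf (measure_pmf p) id s = laplace_transform M Z ((1 - s) / of_real \<theta>)"
proof -
  interpret prob_space M by fact
  \<comment> \<open>\<open>Z\<close> is positive only almost everywhere; the maximum makes the
    Poisson mean nonnegative at every point.\<close>
  define R where "R x = max 0 (Z x) / \<theta>" for x
  have [measurable]: "R \<in> borel_measurable M" unfolding R_def by measurable
  have R0: "R x \<ge> 0" for x using \<theta> by (simp add: R_def)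
  define w where "w i x = exp (- R x) * (R x ^ i / fact i)" for i x
  have [measurable]: "w i \<in> borel_measurable M" for i unfolding w_def by measurable
  have w0: "w i x \<ge> 0" for i x using R0 by (simp add: w_def)
  have w_sums: "(\<lambda>i. of_real (w i x) * s ^ i) sums exp (of_real (R x) * (s - 1))" for x and s :: complex
  proof -
    have "(\<lambda>i. of_real (exp (- R x)) * ((of_real (R x) * s) ^ i /\<^sub>R fact i)) sums
        (of_real (exp (- R x)) * exp (of_real (R x) * s))"
      by (intro sums_mult exp_converges)
    also have "of_real (exp (- R x)) * exp (of_real (R x) * s) = exp (of_real (R x) * (s - 1))"
      by (simp add: algebra_simps flip: exp_add exp_of_real)
    also have "(\<lambda>i. of_real (exp (- R x)) * ((of_real (R x) * s) ^ i /\<^sub>R fact i)) =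
        (\<lambda>i. of_real (w i x) * s ^ i)"
      by (simp add: w_def power_mult_distrib scaleR_conv_of_real field_simps)
    finally show ?thesis .
  qed
  have w1: "(\<lambda>i. w i x) sums 1" for x
  proof -
    have "(\<lambda>i. complex_of_real (w i x)) sums of_real 1" using w_sums[of x 1] by simp
    thus ?thesis by (simp only: sums_of_real_iff)
  qed
  have w_le: "w i x \<le> 1" for i x
  proof -
    have "(\<Sum>j\<in>{i}. w j x) \<le> (\<Sum>j. w j x)"
      using w1[of x] w0 by (intro sum_le_suminf) (auto simp: sums_iff)
    thus ?thesis using w1[of x] by (simp add: sums_iff)
  qed
  have w_int: "integrable M (w i)" for i
    by (rule integrable_const_bound[where B = 1]) (auto simp: w0 w_le)
  define q where "q i = (LINT x|M. w i x)" for i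
  have q0: "q i \<ge> 0" for i unfolding q_def by (simp add: w0)
  have "(\<integral>\<^sup>+i. ennreal (q i) \<partial>count_space UNIV) = (\<Sum>i. ennreal (q i))"
    by (rule nn_integral_count_space_nat)
  also have "\<dots> = (\<Sum>i. \<integral>\<^sup>+x. ennreal (w i x) \<partial>M)"
    unfolding q_def by (subst nn_integral_eq_integral[OF w_int]) (auto simp: w0)
  also have "\<dots> = (\<integral>\<^sup>+x. (\<Sum>i. ennreal (w i x)) \<partial>M)"
    by (intro nn_integral_suminf[symmetric]) measurable
  also have "\<dots> = (\<integral>\<^sup>+x. 1 \<partial>M)"
    using w1 w0 by (intro nn_integral_cong) (simp add: suminf_ennreal_eq sums_iff)
  finally have q1: "(\<integral>\<^sup>+i. ennreal (q i) \<partial>count_space UNIV) = 1"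
    by (simp add: emeasure_space_1)
  define p where "p = embed_pmf q"
  have pmf_p: "pmf p i = q i" for i unfolding p_def by (rule pmf_embed_pmf[OF q0 q1])
  have pgf_p: "(\<lambda>n. of_real (q n) * s ^ n) sums pgf (measure_pmf p) id s" if "norm s \<le> 1" for s
  proof -
    have "measure (measure_pmf p) {x \<in> space (measure_pmf p). id x = n} = q n" for n
      by (simp add: pmf_p[symmetric] measure_pmf_single)
    thus ?thesis
      using pgf_sums[OF measure_pmf.prob_space_axioms, of id p s] that by simp
  qed
  have "summable (\<lambda>n. complex_of_real (q n))" using pgf_p[of 1] by (auto simp: sums_iff)
  hence q_summable: "summable q" by (simp only: summable_complex_of_real)
  have "pgf (measure_pmf p) id s = laplace_transform M Z ((1 - s) / of_real \<theta>)" if s: "norm s \<le> 1" for s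
  proof -
    let ?f = "\<lambda>i x. complex_of_real (w i x) * s ^ i"
    have le: "norm (?f i x) \<le> w i x" for i x
      using s w0[of i x] by (simp add: norm_mult norm_power mult_left_le power_le_one)
    have f_int: "integrable M (?f i)" for i using w_int by (intro integrable_mult_left) simp
    have "(\<lambda>i. CLINT x|M. ?f i x) sums (CLINT x|M. (\<Sum>i. ?f i x))"
    proof (rule sums_integral[OF f_int])
      show "AE x in M. summable (\<lambda>i. norm (?f i x))"
        by (intro AE_I2 summable_comparison_test'[OF sums_summable[OF w1]]) (use le in simp)
      show "summable (\<lambda>i. LINT x|M. norm (?f i x))"
      proof (rule summable_comparison_test'[OF q_summable])
        fix i show "norm (LINT x|M. norm (?f i x)) \<le> q i"
          unfolding q_def using le f_int w_int by (simp add: integral_mono integral_nonneg_AE)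
      qed
    qed
    also have "(\<lambda>i. CLINT x|M. ?f i x) = (\<lambda>n. of_real (q n) * s ^ n)"
      unfolding q_def by simp
    finally have "pgf (measure_pmf p) id s = (CLINT x|M. (\<Sum>i. ?f i x))"
      using sums_unique2 pgf_p[OF s] by blast
    also have "\<dots> = (CLINT x|M. exp (of_real (R x) * (s - 1)))"
      using w_sums by (simp add: sums_iff)
    also have "\<dots> = laplace_transform M Z ((1 - s) / of_real \<theta>)"
      unfolding laplace_transform_def
    proof (rule integral_cong_AE)
      show "AE x in M. exp (of_real (R x) * (s - 1)) = exp (- ((1 - s) / of_real \<theta>) * of_real (Z x))"
        using pos
      proof eventually_elim
        case (elim x)
        hence R: "complex_of_real (R x) = of_real (Z x) / of_real \<theta>" by (simp add: R_def)
        show ?case unfolding R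
          by (rule arg_cong[of _ _ exp]) (use \<theta> in \<open>simp add: field_simps\<close>)
      qed
    qed measurable
    finally show ?thesis .
  qed
  thus ?thesis by (rule that)
qed

text \<open>If \<open>N\<close> is mixed Poisson as above, then \<open>j + k * N\<close> has the
  required PGF.\<close>

lemma ex_wp_member_pmf:
  assumes "prob_space M" "Z \<in> borel_measurable M" "AE x in M. Z x > 0" "\<theta> > 0"
  obtains p :: "nat pmf" where
    "\<And>s. norm s \<le> 1 \<Longrightarrow> pgf (measure_pmf p) id s = wp_member (laplace_transform M Z) j k \<theta> s"
proof -
  obtain p where p: "\<And>s. norm s \<le> 1 \<Longrightarrow>
      pgf (measure_pmf p) id s = laplace_transform M Z ((1 - s) / of_real \<theta>)"
    using ex_mixed_poisson_pmf[OF assms] by blast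
  show ?thesis
  proof (rule that[of "map_pmf (\<lambda>i. j + k * i) p"])
    fix s :: complex assume s: "norm s \<le> 1"
    have "pgf (measure_pmf (map_pmf (\<lambda>i. j + k * i) p)) id s = s ^ j * pgf (measure_pmf p) id (s ^ k)"
      unfolding pgf_def by (simp add: power_add power_mult)
    thus "pgf (measure_pmf (map_pmf (\<lambda>i. j + k * i) p)) id s = wp_member (laplace_transform M Z) j k \<theta> s"
      unfolding wp_member_def using p[of "s ^ k"] s by (simp add: norm_power power_le_one)
  qed
qed

section \<open>Limits of random sums\<close>

text \<open>Laws with characteristic function \<open>exp (- \<psi> n)\<close> form a tight sequence; a subsequential limit
  is infinitely divisible because the \<open>m\<close>-th roots \<open>exp (- \<psi> n / m)\<close> are tight as well.\<close>

lemma cf_exponent_convergent_subsequence: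
  fixes \<psi> :: "nat \<Rightarrow> real \<Rightarrow> complex"
  assumes cf: "\<And>n m. m \<ge> 1 \<Longrightarrow> is_cf (\<lambda>t. exp (- \<psi> n t / of_nat m))"
    and cont: "\<And>n. continuous_on UNIV (\<psi> n)" and zero: "\<And>n. \<psi> n 0 = 0"
    and equi: "\<And>e. e > 0 \<Longrightarrow> \<exists>d>0. \<forall>n t. \<bar>t\<bar> \<le> d \<longrightarrow> norm (\<psi> n t) \<le> e"
  obtains r :: "nat \<Rightarrow> nat" and \<omega> where "strict_mono r" "infinitely_divisible_cf \<omega>"
    "\<And>t. (\<lambda>n. \<psi> (r n) t) \<longlonglongrightarrow> - cf_log \<omega> t"
proof -
  define \<mu> where "\<mu> m n = (SOME \<nu>. real_distribution \<nu> \<and> char \<nu> = (\<lambda>t. exp (- \<psi> n t / of_nat m)))"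
    for m n :: nat
  have "real_distribution (\<mu> m n) \<and> char (\<mu> m n) = (\<lambda>t. exp (- \<psi> n t / of_nat m))"
    if "m \<ge> 1" for m n
    unfolding \<mu>_def using cf[OF that, of n] unfolding is_cf_def 
    by (intro someI_ex[of "\<lambda>\<nu>. real_distribution \<nu> \<and> char \<nu> = (\<lambda>t. exp (- \<psi> n t / of_nat m))"]) auto
  hence \<mu>: "\<And>m n. m \<ge> 1 \<Longrightarrow> real_distribution (\<mu> m n)"
    and char_\<mu>: "\<And>m n. m \<ge> 1 \<Longrightarrow> char (\<mu> m n) = (\<lambda>t. exp (- \<psi> n t / of_nat m))"
    by blast+
  have tight: "tight (\<mu> m)" if m: "m \<ge> 1" for m
  proof (rule tight_if_equicontinuous_char[OF \<mu>[OF m]])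
    fix e :: real assume e: "e > 0"
    have "isCont (exp :: complex \<Rightarrow> complex) 0" by simp
    then obtain \<eta> where \<eta>: "\<eta> > 0" "\<And>v::complex. norm v < \<eta> \<Longrightarrow> norm (exp v - 1) < e"
      using e unfolding continuous_at_eps_delta by (auto simp: dist_norm)
    obtain d where d: "d > 0" "\<And>n t. \<bar>t\<bar> \<le> d \<Longrightarrow> norm (\<psi> n t) \<le> \<eta> / 2"
      using equi[of "\<eta> / 2"] \<eta> by auto
    show "\<exists>d>0. \<forall>n t. \<bar>t\<bar> \<le> d \<longrightarrow> norm (1 - char (\<mu> m n) t) \<le> e"
    proof (rule exI[of _ d], intro conjI allI impI d(1))
      fix n t assume t: "\<bar>t\<bar> \<le> d"
      have "norm (- \<psi> n t / of_nat m) = norm (\<psi> n t) / real m" by (simp add: norm_divide)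
      also have "\<dots> \<le> norm (\<psi> n t)" using m divide_left_mono[of 1 "real m" "norm (\<psi> n t)"] by simp
      also have "\<dots> < \<eta>" using d(2)[OF t, of n] \<eta>(1) by simp
      finally have "norm (exp (- \<psi> n t / of_nat m) - 1) < e" by (rule \<eta>(2))
      thus "norm (1 - char (\<mu> m n) t) \<le> e"
        unfolding char_\<mu>[OF m] by (simp add: norm_minus_commute)
    qed
  qed
  obtain r W where r: "strict_mono (r :: nat \<Rightarrow> nat)" and W: "real_distribution W"
    and conv: "weak_conv_m (\<mu> 1 \<circ> id \<circ> r) W"
    using tight_imp_convergent_subsubsequence[OF tight[of 1] strict_mono_id] by auto
  define \<omega> where "\<omega> = char W"
  have lim: "(\<lambda>n. exp (- \<psi> (r n) t)) \<longlonglongrightarrow> \<omega> t" for t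
    using levy_continuity1[OF _ W conv, of t] by (simp add: \<mu> char_\<mu> \<omega>_def)
  have ID: "infinitely_divisible_cf \<omega>"
    unfolding infinitely_divisible_cf_def
  proof (intro conjI allI impI)
    show "is_cf \<omega>" unfolding \<omega>_def by (rule is_cf_char[OF W])
    fix m :: nat assume m: "m \<ge> 1"
    \<comment> \<open>The further subsequence may depend on \<open>m\<close>: along it the m-th
      powers still converge to the same \<open>\<omega>\<close>, and only the root \<open>G\<close>
      is wanted.\<close>
    obtain r' G where r': "strict_mono (r' :: nat \<Rightarrow> nat)" and G: "real_distribution G"
      and conv': "weak_conv_m (\<mu> m \<circ> r \<circ> r') G"
      using tight_imp_convergent_subsubsequence[OF tight[OF m] r] by auto
    have "\<omega> t = char G t ^ m" for t
    proof (rule LIMSEQ_unique)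
      show "(\<lambda>n. exp (- \<psi> (r (r' n)) t)) \<longlonglongrightarrow> \<omega> t"
        using LIMSEQ_subseq_LIMSEQ[OF lim[of t] r'] by (simp add: comp_def)
      have "(\<lambda>n. exp (- \<psi> (r (r' n)) t / of_nat m)) \<longlonglongrightarrow> char G t"
        using levy_continuity1[OF _ G conv', of t] m by (simp add: \<mu> char_\<mu>)
      hence "(\<lambda>n. exp (- \<psi> (r (r' n)) t / of_nat m) ^ m) \<longlonglongrightarrow> char G t ^ m"
        by (rule tendsto_power)
      moreover have "exp (v / of_nat m) ^ m = exp v" for v :: complex
        using m by (simp add: exp_of_nat_mult[symmetric])
      ultimately show "(\<lambda>n. exp (- \<psi> (r (r' n)) t)) \<longlonglongrightarrow> char G t ^ m" by (simp only:)
    qed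
    thus "\<exists>g. is_cf g \<and> (\<forall>t. \<omega> t = g t ^ m)" using is_cf_char[OF G] by blast
  qed
  have neg: "(\<lambda>n. - \<psi> (r n) t) \<longlonglongrightarrow> cf_log \<omega> t" for t
  proof (rule continuous_log_tendsto[OF ID])
    show "continuous_on UNIV (\<lambda>t. - \<psi> (r n) t)" for n by (intro continuous_intros cont)
    show "uniform_limit {-T..T} (\<lambda>n t. exp (- \<psi> (r n) t)) \<omega> sequentially" for T
      using weak_conv_imp_char_uniform_limit[OF _ W conv, of T] by (simp add: \<mu> char_\<mu> \<omega>_def)
  qed (simp add: zero)
  have "(\<lambda>n. \<psi> (r n) t) \<longlonglongrightarrow> - cf_log \<omega> t" for t
    using tendsto_minus[OF neg[of t]] by simp
  thus ?thesis using that r ID by blast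
qed

text \<open>The other k-th roots of unity are at least \<open>\<delta>\<close> away from 1, so on a
  sphere around 1 of radius below \<open>\<delta>\<close> no k-th power equals 1. Trapping is
  applied after translating 1 to 0.\<close>

lemma power_near_1_connected:
  assumes k: "k \<ge> 1" and \<eta>: "\<eta> > 0"
  obtains \<epsilon> where "\<epsilon> > 0"
    "\<And>C v. connected C \<Longrightarrow> 1 \<in> C \<Longrightarrow> (\<And>w. w \<in> C \<Longrightarrow> norm (w ^ k - 1 :: complex) < \<epsilon>) \<Longrightarrow>
       v \<in> C \<Longrightarrow> norm (v - 1) < \<eta>"
proof -
  have "finite {z::complex. z ^ k = 1}" using finite_roots_unity[of k] k by simp
  then obtain \<delta> where \<delta>: "\<delta> > 0" "\<And>z. z ^ k = 1 \<Longrightarrow> z \<noteq> 1 \<Longrightarrow> \<delta> \<le> dist 1 (z::complex)"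
    using finite_set_avoid[of "{z::complex. z ^ k = 1}" 1] by auto
  define \<eta>' where "\<eta>' = min \<eta> (\<delta> / 2)"
  have \<eta>': "\<eta>' > 0" "\<eta>' \<le> \<eta>" "\<eta>' < \<delta>" using \<delta> \<eta> by (auto simp: \<eta>'_def)
  obtain \<epsilon> where \<epsilon>: "\<epsilon> > 0" and trap: "\<And>C v. connected C \<Longrightarrow> C \<subseteq> UNIV \<Longrightarrow> 0 \<in> C \<Longrightarrow>
      (\<And>w. w \<in> C \<Longrightarrow> norm ((1 + w) ^ k - 1 :: complex) < \<epsilon>) \<Longrightarrow> v \<in> C \<Longrightarrow> norm v < \<eta>'"
  proof (rule connected_within_ball[of UNIV "\<lambda>w. (1 + w) ^ k" \<eta>'])
    show "(1 + v) ^ k \<noteq> 1" if "norm v = \<eta>'" for v :: complex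
      using \<delta>(2)[of "1 + v"] that \<eta>' by (auto simp: dist_norm)
  qed (auto intro!: continuous_intros simp: \<eta>')
  show ?thesis
  proof (rule that[OF \<epsilon>])
    fix C v assume C: "connected C" "1 \<in> C" "\<And>w. w \<in> C \<Longrightarrow> norm (w ^ k - 1 :: complex) < \<epsilon>" "v \<in> C"
    have "norm (v - 1) < \<eta>'"
    proof (rule trap)
      show "connected ((\<lambda>w. w - 1) ` C)"
        by (intro connected_continuous_image continuous_intros C)
    qed (use C in auto)
    thus "norm (v - 1) < \<eta>" using \<eta>' by simp
  qed
qed

text \<open>The finitely many exceptional indices are handled one by one through continuity at 0.
  Tightness needs a bound for every index.\<close>

lemma eventually_equicontinuous_imp_equicontinuous:
  fixes \<psi> :: "nat \<Rightarrow> real \<Rightarrow> 'a::real_normed_vector"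
  assumes ev: "\<exists>d>0. \<forall>\<^sub>F n in sequentially. \<forall>t. \<bar>t\<bar> \<le> d \<longrightarrow> norm (\<psi> n t) \<le> e"
    and cont: "\<And>n. continuous_on UNIV (\<psi> n)" and zero: "\<And>n. \<psi> n 0 = 0" and e: "e > 0"
  shows "\<exists>d>0. \<forall>n t. \<bar>t\<bar> \<le> d \<longrightarrow> norm (\<psi> n t) \<le> e"
proof -
  obtain d0 n0 where d0: "d0 > 0" "\<And>n t. n \<ge> n0 \<Longrightarrow> \<bar>t\<bar> \<le> d0 \<Longrightarrow> norm (\<psi> n t) \<le> e"
    using ev unfolding eventually_sequentially by blast
  have init: "\<exists>d>0. \<forall>n<m. \<forall>t. \<bar>t\<bar> \<le> d \<longrightarrow> norm (\<psi> n t) \<le> e" for m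
  proof (induction m)
    case 0 show ?case by (auto intro: exI[of _ 1])
  next
    case (Suc m)
    then obtain d where d: "d > 0" "\<And>n t. n < m \<Longrightarrow> \<bar>t\<bar> \<le> d \<Longrightarrow> norm (\<psi> n t) \<le> e" by blast
    have "isCont (\<psi> m) 0" using cont by (simp add: continuous_on_eq_continuous_at)
    then obtain d' where d': "d' > 0" "\<And>t. \<bar>t\<bar> < d' \<Longrightarrow> norm (\<psi> m t) < e"
      using e zero unfolding continuous_at_eps_delta by (auto simp: dist_norm)
    show ?case
    proof (intro exI[of _ "min d (d' / 2)"] conjI allI impI)
      show "min d (d' / 2) > 0" using d d' by simp
      fix n t assume n: "n < Suc m" and t: "\<bar>t\<bar> \<le> min d (d' / 2)"
      have "\<bar>t\<bar> \<le> d" "\<bar>t\<bar> < d'" using t d'(1) by auto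
      thus "norm (\<psi> n t) \<le> e" using n d(2)[of n t] d'(2)[of t] by (cases "n = m") auto
    qed
  qed
  obtain d1 where d1: "d1 > 0" "\<And>n t. n < n0 \<Longrightarrow> \<bar>t\<bar> \<le> d1 \<Longrightarrow> norm (\<psi> n t) \<le> e"
    using init[of n0] by blast
  show ?thesis
  proof (intro exI[of _ "min d0 d1"] conjI allI impI)
    fix n t assume "\<bar>t\<bar> \<le> min d0 d1"
    thus "norm (\<psi> n t) \<le> e" using d0(2)[of n t] d1(2)[of n t] by (cases "n < n0") auto
  qed (use d0 d1 in simp)
qed

text \<open>Half of \<open>e\<close> pays for the uniform convergence, half for the continuity of
  \<open>char \<nu>\<close> at 0.\<close>

lemma weak_conv_imp_char_near_0:
  assumes \<mu>: "\<And>n. real_distribution (\<mu> n)" and \<nu>: "real_distribution \<nu>" and w: "weak_conv_m \<mu> \<nu>"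
    and e: "e > 0"
  shows "\<exists>d>0. \<forall>\<^sub>F n in sequentially. \<forall>t. \<bar>t\<bar> \<le> d \<longrightarrow> norm (1 - char (\<mu> n) t) < e"
proof -
  interpret \<nu>: real_distribution \<nu> by (rule \<nu>)
  obtain d where d: "d > 0" "\<And>t. \<bar>t\<bar> < d \<Longrightarrow> norm (char \<nu> t - 1) < e / 2"
    using \<nu>.isCont_char[of 0, unfolded continuous_at_eps_delta, rule_format, of "e / 2"]
      \<nu>.char_zero e by (auto simp: dist_norm)
  have "\<forall>\<^sub>F n in sequentially. \<forall>t\<in>{-(d/2)..d/2}. dist (char (\<mu> n) t) (char \<nu> t) < e / 2"
    using e by (intro uniform_limitD[OF weak_conv_imp_char_uniform_limit[OF \<mu> \<nu> w]]) simp
  hence "\<forall>\<^sub>F n in sequentially. \<forall>t. \<bar>t\<bar> \<le> d / 2 \<longrightarrow> norm (1 - char (\<mu> n) t) < e"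
  proof eventually_elim
    case (elim n)
    show ?case
    proof (intro allI impI)
      fix t assume t: "\<bar>t\<bar> \<le> d / 2"
      have "norm (char (\<mu> n) t - char \<nu> t) < e / 2" 
      proof -
        have "t \<in> {-(d/2)..d/2}" using t by (auto simp: abs_le_iff)
        thus ?thesis using elim by (metis dist_norm)
      qed
      moreover have "norm (char \<nu> t - 1) < e / 2" using t d by (intro d) simp
      ultimately have "norm (char (\<mu> n) t - 1) < e"
        using norm_triangle_ineq[of "char (\<mu> n) t - char \<nu> t" "char \<nu> t - 1"] by simp
      thus "norm (1 - char (\<mu> n) t) < e" by (simp add: norm_minus_commute)
    qed
  qed
  thus ?thesis using d(1) by (intro exI[of _ "d / 2"]) simp
qed

lemma ex_wp_member_sum:
  assumes "prob_space MZ" "Z \<in> borel_measurable MZ" "AE x in MZ. Z x > 0" "\<theta> > 0"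
    and h: "is_cf h"
  obtains M :: "(nat \<times> (nat \<Rightarrow> real)) measure" and N X where
    "iid_with_index M N X"
    "\<And>s. norm s \<le> 1 \<Longrightarrow> pgf M N s = wp_member (laplace_transform MZ Z) j k \<theta> s"
    "\<And>t. char (sum_law M N X) t = wp_member (laplace_transform MZ Z) j k \<theta> (h t)"
proof -
  obtain p :: "nat pmf" where p: "\<And>s. norm s \<le> 1 \<Longrightarrow>
      pgf (measure_pmf p) id s = wp_member (laplace_transform MZ Z) j k \<theta> s"
    using ex_wp_member_pmf[OF assms(1-4)] by blast
  obtain \<mu> where \<mu>: "real_distribution \<mu>" "h = char \<mu>" using h by (rule is_cfE)
  obtain M :: "(nat \<times> (nat \<Rightarrow> real)) measure" and N X where
    M: "iid_with_index M N X" "distr M borel (X 0) = \<mu>" "\<And>s. pgf M N s = pgf (measure_pmf p) id s"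
    using ex_iid_with_index[OF \<mu>(1)] by blast
  show ?thesis
  proof (rule that[OF M(1)])
    show "char (sum_law M N X) t = wp_member (laplace_transform MZ Z) j k \<theta> (h t)" for t
      using char_sum_law[OF M(1), of t] is_cf_norm_le_1[OF h, of t] by (simp add: M(2,3) p \<mu>(2))
  qed (simp add: M(3) p)
qed

text \<open>The constant \<open>Z = 1\<close> has Laplace transform \<open>exp (- v)\<close>, so the
  random sums already constructed, with \<open>j = 0\<close>, include the compound Poisson
  laws.\<close>

lemma is_cf_compound_poisson:
  assumes h: "is_cf h" and \<theta>: "\<theta> > 0"
  shows "is_cf (\<lambda>t. exp (- ((1 - h t ^ k) / of_real \<theta>)))"
proof -
  let ?M = "return (count_space UNIV) ()"
  have M: "prob_space ?M" by (rule prob_space_return) simp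
  interpret prob_space ?M by (rule M)
  have lap: "laplace_transform ?M (\<lambda>_. 1) v = exp (- v)" for v
    unfolding laplace_transform_def using prob_space by simp
  obtain N :: "(nat \<times> (nat \<Rightarrow> real)) measure" and I X where
    N: "iid_with_index N I X" "\<And>t. char (sum_law N I X) t = wp_member (laplace_transform ?M (\<lambda>_. 1)) 0 k \<theta> (h t)"
    by (rule ex_wp_member_sum[OF M _ _ \<theta> h, of "\<lambda>_. 1" 0 k]) auto
  have "char (sum_law N I X) = (\<lambda>t. exp (- ((1 - h t ^ k) / of_real \<theta>)))"
    unfolding N(2) wp_member_def lap by (intro ext) simp
  thus ?thesis using is_cf_char[OF real_distribution_sum_law[OF N(1)]] by simp
qed

lemma laplace_transform_norm_le_1:
  assumes "prob_space M" "Z \<in> borel_measurable M" "AE x in M. Z x > 0" "Re v \<ge> 0"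
  shows "norm (laplace_transform M Z v) \<le> 1"
proof -
  interpret prob_space M by fact
  have "norm (laplace_transform M Z v) \<le> (LINT x|M. norm (exp (- v * of_real (Z x))))"
    unfolding laplace_transform_def by (rule integral_norm_bound)
  also have "\<dots> \<le> (LINT x|M. 1)"
  proof (rule integral_mono_AE)
    show "AE x in M. norm (exp (- v * of_real (Z x))) \<le> 1"
      using assms(3) by eventually_elim (rule norm_exp_neg_mult_le_1[OF assms(4)])
    show "integrable M (\<lambda>x. norm (exp (- v * of_real (Z x))))"
      by (intro integrable_norm integrable_laplace assms)
  qed simp
  finally show ?thesis by (simp add: prob_space)
qed

text \<open>Doubling passes convergence from \<open>s\<close> to \<open>2 * s\<close>; finitely many
  doublings reach any point.\<close>

lemma cf_tendsto_1_everywhere: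
  assumes h: "\<And>n. is_cf (h n)" and d: "d > 0" "\<And>t. \<bar>t\<bar> \<le> d \<Longrightarrow> (\<lambda>n. h n t) \<longlonglongrightarrow> 1"
  shows "(\<lambda>n. h n t) \<longlonglongrightarrow> 1"
proof -
  have step: "(\<lambda>n. h n (2 * s)) \<longlonglongrightarrow> 1" if "(\<lambda>n. h n s) \<longlonglongrightarrow> 1" for s
  proof -
    have "(\<lambda>n. 4 * norm (1 - h n s)) \<longlonglongrightarrow> 4 * norm (1 - 1 :: complex)"
      by (intro tendsto_intros that)
    hence "(\<lambda>n. 4 * norm (1 - h n s)) \<longlonglongrightarrow> 0" by simp
    hence "(\<lambda>n. 1 - h n (2 * s)) \<longlonglongrightarrow> 0"
      by (rule Lim_null_comparison[rotated]) (intro always_eventually allI is_cf_doubling h)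
    from tendsto_diff[OF tendsto_const this, of 1] show ?thesis by simp
  qed
  obtain m where m: "\<bar>t\<bar> / d < 2 ^ m" using real_arch_pow[of 2] by auto
  have 0: "(\<lambda>n. h n (t / 2 ^ m)) \<longlonglongrightarrow> 1"
    using m d(1) by (intro d(2)) (simp add: field_simps)
  have "(\<lambda>n. h n (2 ^ i * (t / 2 ^ m))) \<longlonglongrightarrow> 1" for i
  proof (induction i)
    case (Suc i) thus ?case using step[of "2 ^ i * (t / 2 ^ m)"] by (simp add: mult_ac)
  qed (use 0 in simp)
  from this[of m] show ?thesis by simp
qed

text \<open>\<open>char L\<close> is the limit along the whole sequence, so it may be computed along
  any subsequence on which \<open>\<psi>\<close> converges. No uniqueness of \<open>\<omega>\<close>
  is claimed.\<close>

lemma wp_member_limit: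
  fixes h :: "nat \<Rightarrow> real \<Rightarrow> complex" and \<theta> :: "nat \<Rightarrow> real"
  assumes MZ: "prob_space MZ" and Z: "Z \<in> borel_measurable MZ" and pos: "AE x in MZ. Z x > 0"
    and k: "k \<ge> 1" and h: "\<And>n. is_cf (h n)" and \<theta>: "\<And>n. \<theta> n > 0" "\<theta> \<longlonglongrightarrow> 0"
    and \<mu>: "\<And>n. real_distribution (\<mu> n)" and L: "real_distribution L" and w: "weak_conv_m \<mu> L"
    and char_\<mu>: "\<And>n t. char (\<mu> n) t = wp_member (laplace_transform MZ Z) j k (\<theta> n) (h n t)"
  obtains \<omega> where "infinitely_divisible_cf \<omega>"
    "\<And>t. char L t = laplace_transform MZ Z (- cf_log \<omega> t)"
proof -
  define \<phi> where "\<phi> = laplace_transform MZ Z"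
  let ?H = "{v::complex. Re v \<ge> 0}"
  have H: "closed ?H" by (simp add: closed_halfspace_Re_ge)
  have \<phi>_cont: "continuous_on ?H \<phi>" unfolding \<phi>_def by (rule continuous_on_laplace_transform[OF MZ Z pos])
  have \<phi>_le: "norm (\<phi> v) \<le> 1" if "Re v \<ge> 0" for v
    unfolding \<phi>_def by (rule laplace_transform_norm_le_1[OF MZ Z pos that])
  define \<psi> where "\<psi> n t = (1 - h n t ^ k) / of_real (\<theta> n)" for n t
  have char_\<mu>': "char (\<mu> n) t = h n t ^ j * \<phi> (\<psi> n t)" for n t
    by (simp add: char_\<mu> wp_member_def \<phi>_def \<psi>_def)
  have hk_le: "norm (h n t ^ i) \<le> 1" for n t i
    using is_cf_norm_le_1[OF h] by (simp add: norm_power power_le_one)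
  have Re_\<psi>: "Re (\<psi> n t) = (1 - Re (h n t ^ k)) / \<theta> n" for n t
    by (simp add: \<psi>_def)
  have \<psi>_H: "Re (\<psi> n t) \<ge> 0" for n t
    unfolding Re_\<psi> using \<theta>(1)[of n] hk_le[of n t k] complex_Re_le_cmod[of "h n t ^ k"]
    by (intro divide_nonneg_pos) linarith+
  have \<psi>_cont: "continuous_on A (\<psi> n)" for A n
    unfolding \<psi>_def using \<theta>(1)[of n] by (intro continuous_intros is_cf_continuous h) auto
  have \<psi>_0: "\<psi> n 0 = 0" for n by (simp add: \<psi>_def is_cf_0[OF h])

  obtain d1 where d1: "d1 > 0"
    and ev1: "\<forall>\<^sub>F n in sequentially. \<forall>t. \<bar>t\<bar> \<le> d1 \<longrightarrow> norm (1 - char (\<mu> n) t) < 1 / 2"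
    using weak_conv_imp_char_near_0[OF \<mu> L w, of "1 / 2"] by auto
  obtain C0 where C0: "\<And>v. Re v \<ge> 0 \<Longrightarrow> norm (\<phi> v) \<ge> 1 / 2 \<Longrightarrow> Re v \<le> C0"
    using laplace_transform_Re_bounded[OF MZ Z pos] unfolding \<phi>_def by blast
  define C where "C = max 1 C0"
  have C: "C > 0" by (simp add: C_def)
  \<comment> \<open>A value within 1/2 of 1 has modulus at least 1/2, and removing the factor
    \<open>h ^ j\<close> of modulus at most 1 cannot lower it.\<close>
  have ev_C: "\<forall>\<^sub>F n in sequentially. \<forall>t. \<bar>t\<bar> \<le> d1 \<longrightarrow> Re (\<psi> n t) \<le> C"
    using ev1
  proof eventually_elim
    case (elim n)
    show ?case
    proof (intro allI impI)
      fix t assume "\<bar>t\<bar> \<le> d1"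
      hence "norm (1 - char (\<mu> n) t) < 1 / 2" using elim by blast
      moreover have "1 \<le> norm (1 - char (\<mu> n) t) + norm (char (\<mu> n) t)"
        using norm_triangle_ineq[of "1 - char (\<mu> n) t" "char (\<mu> n) t"] by simp
      moreover have "norm (char (\<mu> n) t) \<le> norm (\<phi> (\<psi> n t))"
        unfolding char_\<mu>' norm_mult using hk_le by (intro mult_left_le_one_le) auto
      ultimately have "norm (\<phi> (\<psi> n t)) \<ge> 1 / 2" by linarith
      from C0[OF \<psi>_H this] show "Re (\<psi> n t) \<le> C" by (simp add: C_def)
    qed
  qed
  \<comment> \<open>|1 - h^k|^2 \<le> 2 (1 - Re h^k) = 2 \<theta> Re \<psi> \<le> 2 \<theta> C,
    whence the threshold \<open>\<epsilon>\<^sup>2 / (2 * C)\<close> for \<open>\<theta>\<close>.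
    Connectedness of the image of the interval then passes from \<open>h ^ k\<close> to
    \<open>h\<close>.\<close>
  have ev_h: "\<forall>\<^sub>F n in sequentially. \<forall>t. \<bar>t\<bar> \<le> d1 \<longrightarrow> norm (h n t - 1) < \<eta>" if \<eta>: "\<eta> > 0" for \<eta>
  proof -
    obtain \<epsilon> where \<epsilon>: "\<epsilon> > 0" and trap: "\<And>C v. connected C \<Longrightarrow> 1 \<in> C \<Longrightarrow>
        (\<And>w. w \<in> C \<Longrightarrow> norm (w ^ k - 1 :: complex) < \<epsilon>) \<Longrightarrow> v \<in> C \<Longrightarrow> norm (v - 1) < \<eta>"
      using power_near_1_connected[OF k \<eta>] by blast
    have "\<forall>\<^sub>F n in sequentially. \<theta> n < \<epsilon>\<^sup>2 / (2 * C)"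
      using \<theta>(2) \<epsilon> C by (intro order_tendstoD) auto
    with ev_C show ?thesis
    proof eventually_elim
      case (elim n)
      have small: "norm (h n s ^ k - 1) < \<epsilon>" if s: "\<bar>s\<bar> \<le> d1" for s
      proof -
        have "(norm (1 - h n s ^ k))\<^sup>2 \<le> 2 * (1 - Re (h n s ^ k))"
          by (rule norm_sq_one_minus_le[OF hk_le])
        also have "\<dots> = 2 * (\<theta> n * Re (\<psi> n s))"
          unfolding Re_\<psi> using \<theta>(1)[of n] by simp
        also have "\<dots> \<le> 2 * (\<theta> n * C)"
          using elim(1) s \<theta>(1)[of n] by (intro mult_left_mono) auto
        also have "\<dots> < \<epsilon>\<^sup>2" using elim(2) C by (simp add: field_simps)
        finally have "norm (1 - h n s ^ k) < \<epsilon>" by (rule power_less_imp_less_base) (use \<epsilon> in simp)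
        thus ?thesis by (simp add: norm_minus_commute)
      qed
      show ?case
      proof (intro allI impI)
        fix t assume t: "\<bar>t\<bar> \<le> d1"
        show "norm (h n t - 1) < \<eta>"
        proof (rule trap)
          show "connected (h n ` {-d1..d1})"
            by (intro connected_continuous_image is_cf_continuous h) simp
          show "1 \<in> h n ` {-d1..d1}" using is_cf_0[OF h, of n] d1 by (intro image_eqI[of _ _ 0]) auto
          show "h n t \<in> h n ` {-d1..d1}" using t by (intro imageI) (auto simp: abs_le_iff)
          show "norm (w ^ k - 1) < \<epsilon>" if "w \<in> h n ` {-d1..d1}" for w
            using that small by (auto simp: abs_le_iff)
        qed
      qed
    qed
  qed
  have h_lim: "(\<lambda>n. h n t) \<longlonglongrightarrow> 1" for t
  proof (rule cf_tendsto_1_everywhere[OF h d1])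
    fix s assume s: "\<bar>s\<bar> \<le> d1"
    show "(\<lambda>n. h n s) \<longlonglongrightarrow> 1"
    proof (rule tendstoI)
      fix e :: real assume "e > 0"
      from ev_h[OF this] show "\<forall>\<^sub>F n in sequentially. dist (h n s) 1 < e"
        by eventually_elim (use s in \<open>simp add: dist_norm\<close>)
    qed
  qed

  obtain \<eta>0 where \<eta>0: "\<eta>0 > 0" "\<And>v. Re v \<ge> 0 \<Longrightarrow> 0 < norm v \<Longrightarrow> norm v < \<eta>0 \<Longrightarrow> \<phi> v \<noteq> 1"
    using laplace_transform_neq_1[OF MZ Z pos] unfolding \<phi>_def by blast
  have equi: "\<exists>d>0. \<forall>n t. \<bar>t\<bar> \<le> d \<longrightarrow> norm (\<psi> n t) \<le> e" if e: "e > 0" for e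
  proof (rule eventually_equicontinuous_imp_equicontinuous[OF _ \<psi>_cont \<psi>_0 e])
    \<comment> \<open>Below \<open>\<eta>0\<close>, so that \<open>\<phi>\<close> avoids the value 1
      on the half-circle of radius \<open>\<eta>\<close>.\<close>
    define \<eta> where "\<eta> = min e (\<eta>0 / 2)"
    have \<eta>: "\<eta> > 0" "\<eta> \<le> e" "\<eta> < \<eta>0" using e \<eta>0(1) by (auto simp: \<eta>_def)
    obtain \<epsilon> where \<epsilon>: "\<epsilon> > 0" and trap: "\<And>C v. connected C \<Longrightarrow> C \<subseteq> ?H \<Longrightarrow> 0 \<in> C \<Longrightarrow>
        (\<And>w. w \<in> C \<Longrightarrow> norm (\<phi> w - 1) < \<epsilon>) \<Longrightarrow> v \<in> C \<Longrightarrow> norm v < \<eta>"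
      by (rule connected_within_ball[OF H \<phi>_cont, of \<eta>]) (use \<eta> \<eta>0(2) in auto)
    obtain d2 where d2: "d2 > 0"
      and ev2: "\<forall>\<^sub>F n in sequentially. \<forall>t. \<bar>t\<bar> \<le> d2 \<longrightarrow> norm (1 - char (\<mu> n) t) < \<epsilon> / 2"
      using weak_conv_imp_char_near_0[OF \<mu> L w, of "\<epsilon> / 2"] \<epsilon> by auto
    define d where "d = min d1 d2"
    have d: "d > 0" "d \<le> d1" "d \<le> d2" using d1 d2 by (auto simp: d_def)
    \<comment> \<open>Since |1 - h^j| \<le> j |1 - h|, this closeness of \<open>h\<close> costs at
      most half of \<open>\<epsilon>\<close>; the added 1 covers \<open>j = 0\<close>.\<close>
    have "\<epsilon> / (2 * (real j + 1)) > 0" using \<epsilon> by simp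
    from ev2 ev_h[OF this]
    have "\<forall>\<^sub>F n in sequentially. \<forall>t. \<bar>t\<bar> \<le> d \<longrightarrow> norm (\<psi> n t) \<le> e"
    proof eventually_elim
      case (elim n)
      have small: "norm (\<phi> (\<psi> n s) - 1) < \<epsilon>" if s: "\<bar>s\<bar> \<le> d" for s
      proof -
        have "norm (1 - h n s ^ j) \<le> real j * norm (1 - h n s)"
          using norm_power_diff[of 1 "h n s" j] is_cf_norm_le_1[OF h] by simp
        also have "\<dots> \<le> (real j + 1) * norm (1 - h n s)" by (intro mult_right_mono) auto
        also have "\<dots> < (real j + 1) * (\<epsilon> / (2 * (real j + 1)))"
          using elim(2) s d by (intro mult_strict_left_mono) (auto simp: norm_minus_commute)
        also have "\<dots> = \<epsilon> / 2" by (simp add: field_simps)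
        finally have 1: "norm (1 - h n s ^ j) < \<epsilon> / 2" .
        have "\<phi> (\<psi> n s) - 1 = \<phi> (\<psi> n s) * (1 - h n s ^ j) - (1 - char (\<mu> n) s)"
          unfolding char_\<mu>' by (simp add: algebra_simps)
        also have "norm \<dots> \<le> norm (\<phi> (\<psi> n s)) * norm (1 - h n s ^ j) + norm (1 - char (\<mu> n) s)"
          unfolding norm_mult[symmetric] by (rule norm_triangle_ineq4)
        also have "\<dots> \<le> norm (1 - h n s ^ j) + norm (1 - char (\<mu> n) s)"
          using \<phi>_le[OF \<psi>_H] by (intro add_right_mono mult_left_le_one_le) auto
        also have "\<dots> < \<epsilon>" using 1 elim(1)[rule_format, of s] s d by simp
        finally show ?thesis .
      qed
      show ?case
      proof (intro allI impI)
        fix t assume t: "\<bar>t\<bar> \<le> d"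
        have "norm (\<psi> n t) < \<eta>"
        proof (rule trap)
          show "connected (\<psi> n ` {-d..d})" by (intro connected_continuous_image \<psi>_cont) simp
          show "\<psi> n ` {-d..d} \<subseteq> ?H" using \<psi>_H by auto
          show "0 \<in> \<psi> n ` {-d..d}" using \<psi>_0[of n] d by (intro image_eqI[of _ _ 0]) auto
          show "\<psi> n t \<in> \<psi> n ` {-d..d}" using t by (intro imageI) (auto simp: abs_le_iff)
          show "norm (\<phi> w - 1) < \<epsilon>" if "w \<in> \<psi> n ` {-d..d}" for w
            using that small by (auto simp: abs_le_iff)
        qed
        thus "norm (\<psi> n t) \<le> e" using \<eta> by simp
      qed
    qed
    thus "\<exists>d>0. \<forall>\<^sub>F n in sequentially. \<forall>t. \<bar>t\<bar> \<le> d \<longrightarrow> norm (\<psi> n t) \<le> e" using d(1) by blast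
  qed

  \<comment> \<open>Dividing \<open>\<psi>\<close> by \<open>m\<close> amounts to replacing
    \<open>\<theta>\<close> by \<open>\<theta> * m\<close>, so the roots are compound Poisson
    too.\<close>
  have cf: "is_cf (\<lambda>t. exp (- \<psi> n t / of_nat m))" if m: "m \<ge> 1" for n m
  proof -
    have "is_cf (\<lambda>t. exp (- ((1 - h n t ^ k) / of_real (\<theta> n * real m))))"
      using \<theta>(1)[of n] m by (intro is_cf_compound_poisson h) simp
    thus ?thesis by (simp add: \<psi>_def)
  qed
  obtain r :: "nat \<Rightarrow> nat" and \<omega> where r: "strict_mono r" and \<omega>: "infinitely_divisible_cf \<omega>"
    and \<psi>_lim: "\<And>t. (\<lambda>n. \<psi> (r n) t) \<longlonglongrightarrow> - cf_log \<omega> t"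
    using cf_exponent_convergent_subsequence[of \<psi>, OF cf \<psi>_cont \<psi>_0 equi] by blast
  show ?thesis
  proof (rule that[OF \<omega>])
    fix t
    have "(\<lambda>n. \<phi> (\<psi> (r n) t)) \<longlonglongrightarrow> \<phi> (- cf_log \<omega> t)"
      by (rule continuous_on_tendsto_compose[OF \<phi>_cont \<psi>_lim])
         (use infinitely_divisible_cf_log_Re_le_0[OF \<omega>, of t] \<psi>_H in auto)
    moreover have "(\<lambda>n. h (r n) t) \<longlonglongrightarrow> 1"
      using LIMSEQ_subseq_LIMSEQ[OF h_lim r] by (simp add: comp_def)
    ultimately have "(\<lambda>n. h (r n) t ^ j * \<phi> (\<psi> (r n) t)) \<longlonglongrightarrow> 1 ^ j * \<phi> (- cf_log \<omega> t)"
      by (intro tendsto_intros)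
    hence "(\<lambda>n. char (\<mu> (r n)) t) \<longlonglongrightarrow> \<phi> (- cf_log \<omega> t)" by (simp add: char_\<mu>')
    moreover have "(\<lambda>n. char (\<mu> (r n)) t) \<longlonglongrightarrow> char L t"
      using LIMSEQ_subseq_LIMSEQ[OF levy_continuity1[OF \<mu> L w] r] by (simp add: comp_def)
    ultimately show "char L t = laplace_transform MZ Z (- cf_log \<omega> t)"
      unfolding \<phi>_def by (rule LIMSEQ_unique[rotated])
  qed
qed

section \<open>The converse: sums built from roots of an infinitely divisible law\<close>

lemma inverse_ceiling_inverse_ratio_tendsto:
  fixes \<theta> :: "nat \<Rightarrow> real"
  assumes \<theta>: "\<And>n. \<theta> n > 0" "\<theta> \<longlonglongrightarrow> 0"
  shows "(\<lambda>n. (1 / real (nat \<lceil>1 / \<theta> n\<rceil>)) / \<theta> n) \<longlonglongrightarrow> 1"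
proof (rule tendsto_sandwich)
  \<comment> \<open>Rounding up gives 1 \<le> m \<theta> \<le> 1 + \<theta> for the ceiling m, and
    the ratio is 1 / (m \<theta>).\<close>
  have bounds: "1 / (1 + \<theta> n) \<le> (1 / real (nat \<lceil>1 / \<theta> n\<rceil>)) / \<theta> n \<and>
      (1 / real (nat \<lceil>1 / \<theta> n\<rceil>)) / \<theta> n \<le> 1" for n
  proof -
    define m where "m = real (nat \<lceil>1 / \<theta> n\<rceil>)"
    have "m = of_int \<lceil>1 / \<theta> n\<rceil>" using \<theta>(1)[of n] by (simp add: m_def)
    hence m: "1 / \<theta> n \<le> m" "m < 1 / \<theta> n + 1" by linarith+
    have m\<theta>: "1 \<le> m * \<theta> n" "m * \<theta> n \<le> 1 + \<theta> n"
      using m \<theta>(1)[of n] by (simp_all add: field_simps)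
    have "(1 / m) / \<theta> n = 1 / (m * \<theta> n)" by simp
    thus ?thesis unfolding m_def[symmetric] using m\<theta> \<theta>(1)[of n]
      by (auto simp: divide_le_eq intro!: divide_left_mono)
  qed
  show "\<forall>\<^sub>F n in sequentially. 1 / (1 + \<theta> n) \<le> (1 / real (nat \<lceil>1 / \<theta> n\<rceil>)) / \<theta> n"
    "\<forall>\<^sub>F n in sequentially. (1 / real (nat \<lceil>1 / \<theta> n\<rceil>)) / \<theta> n \<le> 1"
    using bounds by simp_all
  have "(\<lambda>n. 1 / (1 + \<theta> n)) \<longlonglongrightarrow> 1 / (1 + 0)" by (intro tendsto_intros \<theta>) simp
  thus "(\<lambda>n. 1 / (1 + \<theta> n)) \<longlonglongrightarrow> 1" by simp
qed simp

text \<open>The derivative of \<open>exp (z * x)\<close> at 0, taken along the nonzero steps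
  \<open>a n\<close> and rescaled by \<open>a n / \<theta> n\<close>.\<close>

lemma exp_difference_quotient_tendsto:
  fixes a \<theta> :: "nat \<Rightarrow> real" and z :: complex
  assumes a: "\<And>n. a n > 0" and \<theta>: "\<And>n. \<theta> n > 0" "\<theta> \<longlonglongrightarrow> 0" and ratio: "(\<lambda>n. a n / \<theta> n) \<longlonglongrightarrow> 1"
  shows "a \<longlonglongrightarrow> 0" "(\<lambda>n. (1 - exp (z * of_real (a n))) / of_real (\<theta> n)) \<longlonglongrightarrow> - z"
proof -
  have "(\<lambda>n. a n / \<theta> n * \<theta> n) \<longlonglongrightarrow> 1 * 0" by (intro tendsto_mult ratio \<theta>)
  moreover have "a n / \<theta> n * \<theta> n = a n" for n using \<theta>(1)[of n] by simp
  ultimately show a0: "a \<longlonglongrightarrow> 0" by simp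
  have "((\<lambda>x. exp (z * x)) has_field_derivative z) (at 0)"
    by (auto intro!: derivative_eq_intros)
  hence D: "((\<lambda>h. (exp (z * h) - 1) / h) \<longlongrightarrow> z) (at 0)" by (simp add: DERIV_def)
  have "filterlim (\<lambda>n. complex_of_real (a n)) (at 0) sequentially"
    using tendsto_of_real[OF a0, where 'a = complex] a
    by (intro filterlim_atI) (auto simp: less_imp_neq[symmetric])
  from filterlim_compose[OF D this]
  have 1: "(\<lambda>n. (exp (z * of_real (a n)) - 1) / of_real (a n)) \<longlonglongrightarrow> z" .
  have 2: "(\<lambda>n. complex_of_real (a n / \<theta> n)) \<longlonglongrightarrow> 1"
    using tendsto_of_real[OF ratio, where 'a = complex] by simp
  have "(\<lambda>n. - ((exp (z * of_real (a n)) - 1) / of_real (a n) * complex_of_real (a n / \<theta> n))) \<longlonglongrightarrow> - (z * 1)"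
    by (intro tendsto_minus tendsto_mult 1 2)
  moreover have "- ((exp (z * of_real (a n)) - 1) / of_real (a n) * complex_of_real (a n / \<theta> n)) =
      (1 - exp (z * of_real (a n))) / of_real (\<theta> n)" for n
    using a[of n] \<theta>(1)[of n] by (simp add: field_simps)
  ultimately show "(\<lambda>n. (1 - exp (z * of_real (a n))) / of_real (\<theta> n)) \<longlonglongrightarrow> - z" by simp
qed

text \<open>The factor \<open>k\<close> in the root order cancels against the k-th power, leaving
  \<open>exp (z / m)\<close> with m the ceiling of \<open>1 / \<theta>\<close>; the root itself
  tends to 1, so its j-th power leaves no trace.\<close>

lemma wp_member_root_tendsto:
  fixes \<theta> :: "nat \<Rightarrow> real"
  assumes MZ: "prob_space MZ" "Z \<in> borel_measurable MZ" "AE x in MZ. Z x > 0"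
    and k: "k \<ge> 1" and z: "Re z \<le> 0" and \<theta>: "\<And>n. \<theta> n > 0" "\<theta> \<longlonglongrightarrow> 0"
  shows "(\<lambda>n. wp_member (laplace_transform MZ Z) j k (\<theta> n)
    (exp (z / of_nat (k * nat \<lceil>1 / \<theta> n\<rceil>)))) \<longlonglongrightarrow> laplace_transform MZ Z (- z)"
proof -
  define a where "a n = 1 / real (nat \<lceil>1 / \<theta> n\<rceil>)" for n
  have a: "a n > 0" for n using \<theta>(1)[of n] by (simp add: a_def)
  note lim = exp_difference_quotient_tendsto[OF a \<theta>
      inverse_ceiling_inverse_ratio_tendsto[OF \<theta>, folded a_def]]
  define h where "h n = exp (z / of_nat (k * nat \<lceil>1 / \<theta> n\<rceil>))" for n
  have h_eq: "h n = exp (z / of_nat k * of_real (a n))" for n by (simp add: h_def a_def)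
  have hk: "h n ^ k = exp (z * of_real (a n))" for n
    unfolding h_eq using k by (simp add: exp_of_nat_mult[symmetric])
  have "h \<longlonglongrightarrow> exp (z / of_nat k * of_real 0)"
    unfolding h_eq[abs_def] by (intro tendsto_intros lim(1))
  hence "(\<lambda>n. h n ^ j) \<longlonglongrightarrow> 1 ^ j" by (intro tendsto_power) simp
  moreover have "(\<lambda>n. laplace_transform MZ Z ((1 - h n ^ k) / of_real (\<theta> n))) \<longlonglongrightarrow> laplace_transform MZ Z (- z)"
  proof (rule continuous_on_tendsto_compose[OF continuous_on_laplace_transform[OF MZ]])
    show "(\<lambda>n. (1 - h n ^ k) / of_real (\<theta> n)) \<longlonglongrightarrow> - z" unfolding hk by (rule lim(2))
    have "Re ((1 - h n ^ k) / of_real (\<theta> n)) \<ge> 0" for n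
    proof -
      have "norm (h n ^ k) \<le> 1" unfolding hk using z a[of n] by (simp add: mult_nonpos_nonneg)
      hence "Re (h n ^ k) \<le> 1" using complex_Re_le_cmod order_trans by blast
      thus ?thesis using \<theta>(1)[of n] by simp
    qed
    thus "\<forall>\<^sub>F n in sequentially. (1 - h n ^ k) / of_real (\<theta> n) \<in> {v. Re v \<ge> 0}" by simp
  qed (use z in simp)
  ultimately have "(\<lambda>n. h n ^ j * laplace_transform MZ Z ((1 - h n ^ k) / of_real (\<theta> n)))
      \<longlonglongrightarrow> 1 ^ j * laplace_transform MZ Z (- z)" by (rule tendsto_mult)
  thus ?thesis by (simp add: wp_member_def h_def)
qed

lemma infinitely_divisible_cf_exp_log:
  assumes \<omega>: "infinitely_divisible_cf \<omega>" and n: "n \<ge> 1"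
  shows "is_cf (\<lambda>t. exp (cf_log \<omega> t / of_nat n))"
proof -
  obtain g where g: "is_cf g" "\<And>t. \<omega> t = g t ^ n"
    using \<omega> n unfolding infinitely_divisible_cf_def by blast
  have "g = (\<lambda>t. exp (cf_log \<omega> t / of_nat n))" using cf_root_eq_exp[OF \<omega> g n] by blast
  thus ?thesis using g(1) by simp
qed

section \<open>The two halves for families indexed by the parameter set\<close>

lemma N_sum_limit_phi_ID:
  fixes \<Theta> :: "real set" and M :: "real \<Rightarrow> 'a measure" and \<theta>s :: "nat \<Rightarrow> real"
  assumes \<Theta>: "\<Theta> \<subseteq> {0<..}"
    and MZ: "prob_space MZ" "Z \<in> borel_measurable MZ" "AE x in MZ. Z x > 0"
    and \<phi>: "\<phi> = laplace_transform MZ Z" and k: "k \<ge> 1"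
    and iid: "\<And>\<theta>. \<theta> \<in> \<Theta> \<Longrightarrow> iid_with_index (M \<theta>) (N \<theta>) (X \<theta>)"
    and pgf_N: "\<And>\<theta> s::real. \<theta> \<in> \<Theta> \<Longrightarrow> 0 < s \<Longrightarrow> s < 1 \<Longrightarrow>
      pgf (M \<theta>) (N \<theta>) (of_real s) = wp_member \<phi> j k \<theta> (of_real s)"
    and \<theta>s: "\<And>n. \<theta>s n \<in> \<Theta>" "decseq \<theta>s" "\<theta>s \<longlonglongrightarrow> 0"
    and L: "real_distribution L"
    and w: "weak_conv_m (\<lambda>n. sum_law (M (\<theta>s n)) (N (\<theta>s n)) (X (\<theta>s n))) L"
  shows "phi_ID \<Theta> \<phi> (char L)"
proof -
  define h where "h \<theta> = char (distr (M \<theta>) borel (X \<theta> 0))" for \<theta>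
  have h: "is_cf (h \<theta>)" if "\<theta> \<in> \<Theta>" for \<theta>
  proof -
    interpret prob_space "M \<theta>" using iid[OF that] unfolding iid_with_index_def by auto
    show ?thesis unfolding h_def
      by (intro is_cf_char real_distribution_distr iid_with_index_measurable(2)[OF iid[OF that]])
  qed
  have pos: "\<theta> > 0" if "\<theta> \<in> \<Theta>" for \<theta> using \<Theta> that by auto
  have pgf: "is_pgf (wp_member \<phi> j k \<theta>)" if "\<theta> \<in> \<Theta>" for \<theta>
    unfolding is_pgf_def \<phi> by (metis ex_wp_member_pmf[OF MZ pos[OF that]])
  have char_sum: "char (sum_law (M \<theta>) (N \<theta>) (X \<theta>)) t = wp_member \<phi> j k \<theta> (h \<theta> t)"
    if \<theta>: "\<theta> \<in> \<Theta>" for \<theta> t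
  proof -
    obtain p :: "nat pmf" where p: "\<And>s. norm s \<le> 1 \<Longrightarrow> pgf (measure_pmf p) id s = wp_member \<phi> j k \<theta> s"
      using ex_wp_member_pmf[OF MZ pos[OF \<theta>]] unfolding \<phi> by blast
    have "char (sum_law (M \<theta>) (N \<theta>) (X \<theta>)) t = pgf (M \<theta>) (N \<theta>) (h \<theta> t)"
      unfolding h_def by (rule char_sum_law[OF iid[OF \<theta>]])
    \<comment> \<open>The PGF of \<open>N\<close> is prescribed on (0,1) only; comparison with
      \<open>p\<close> carries the formula to the complex point \<open>h \<theta> t\<close>.\<close>
    also have "\<dots> = pgf (measure_pmf p) id (h \<theta> t)"
    proof (rule pgf_eq_if_eq_on_real)
      show "prob_space (M \<theta>)" using iid[OF \<theta>] unfolding iid_with_index_def by auto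
      show "N \<theta> \<in> measurable (M \<theta>) (count_space UNIV)" by (rule iid_with_index_measurable(1)[OF iid[OF \<theta>]])
      show "pgf (M \<theta>) (N \<theta>) (of_real s) = pgf (measure_pmf p) id (of_real s)" if "0 < s" "s < 1" for s :: real
        using pgf_N[OF \<theta> that] p[of "of_real s"] that by simp
    qed (simp_all add: measure_pmf.prob_space_axioms is_cf_norm_le_1[OF h[OF \<theta>]])
    also have "\<dots> = wp_member \<phi> j k \<theta> (h \<theta> t)" by (intro p is_cf_norm_le_1 h \<theta>)
    finally show ?thesis .
  qed
  note real = real_distribution_sum_law[OF iid[OF \<theta>s(1)]]
  obtain \<omega> where \<omega>: "infinitely_divisible_cf \<omega>" "\<And>t. char L t = \<phi> (- cf_log \<omega> t)"
    using wp_member_limit[OF MZ k h[OF \<theta>s(1)] pos[OF \<theta>s(1)] \<theta>s(3) real L w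
        char_sum[OF \<theta>s(1), unfolded \<phi>]] unfolding \<phi> by blast
  have lim: "(\<lambda>n. wp_member \<phi> j k (\<theta>s n) (h (\<theta>s n) t)) \<longlonglongrightarrow> char L t" for t
    using levy_continuity1[OF real L w, of t] by (simp add: char_sum \<theta>s(1))
  \<comment> \<open>The PGFs demanded by \<open>phi_ID\<close> are the members
    \<open>wp_member \<phi> j k \<theta>\<close> themselves, and the summands are the given
    ones.\<close>
  show ?thesis
    unfolding phi_ID_def
  proof (intro conjI exI)
    show "\<forall>\<theta>\<in>\<Theta>. is_cf (h \<theta>) \<and> is_pgf (wp_member \<phi> j k \<theta>)" using h pgf by blast
    show "\<forall>t. (\<lambda>n. wp_member \<phi> j k (\<theta>s n) (h (\<theta>s n) t)) \<longlonglongrightarrow> char L t" using lim by blast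
  qed (use is_cf_char[OF L] \<omega> \<theta>s in auto)
qed

text \<open>The summands depend on \<open>\<omega>\<close>, \<open>k\<close> and
  \<open>\<theta>\<close> but on no sequence, so one family serves every null sequence in
  \<open>\<Theta>\<close>.\<close>

lemma phi_ID_N_sum_limit:
  fixes \<Theta> :: "real set"
  assumes \<Theta>: "\<Theta> \<subseteq> {0<..}"
    and MZ: "prob_space MZ" "Z \<in> borel_measurable MZ" "AE x in MZ. Z x > 0"
    and \<phi>: "\<phi> = laplace_transform MZ Z" and k: "k \<ge> 1"
    and L: "real_distribution L" and ID: "phi_ID \<Theta> \<phi> (char L)"
  obtains M :: "real \<Rightarrow> (nat \<times> (nat \<Rightarrow> real)) measure" and N X where
    "\<And>\<theta>. \<theta> \<in> \<Theta> \<Longrightarrow> iid_with_index (M \<theta>) (N \<theta>) (X \<theta>)"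
    "\<And>\<theta> s. \<theta> \<in> \<Theta> \<Longrightarrow> norm s \<le> 1 \<Longrightarrow> pgf (M \<theta>) (N \<theta>) s = wp_member \<phi> j k \<theta> s"
    "\<And>\<theta>s. (\<And>n. \<theta>s n \<in> \<Theta>) \<Longrightarrow> \<theta>s \<longlonglongrightarrow> 0 \<Longrightarrow>
       weak_conv_m (\<lambda>n. sum_law (M (\<theta>s n)) (N (\<theta>s n)) (X (\<theta>s n))) L"
proof -
  obtain \<omega> where \<omega>: "infinitely_divisible_cf \<omega>" "\<And>t. char L t = \<phi> (- cf_log \<omega> t)"
    using ID unfolding phi_ID_def by blast
  have pos: "\<theta> > 0" if "\<theta> \<in> \<Theta>" for \<theta> using \<Theta> that by auto
  define h where "h \<theta> = (\<lambda>t. exp (cf_log \<omega> t / of_nat (k * nat \<lceil>1 / \<theta>\<rceil>)))" for \<theta> :: real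
  have h: "is_cf (h \<theta>)" if "\<theta> \<in> \<Theta>" for \<theta>
    unfolding h_def using k pos[OF that] by (intro infinitely_divisible_cf_exp_log \<omega>(1)) (simp add: Suc_le_eq)
  \<comment> \<open>Space, index and summands are bundled into a triple so that a single choice over
    \<open>\<theta>\<close> provides all three.\<close>
  let ?P = "\<lambda>\<theta> (M :: (nat \<times> (nat \<Rightarrow> real)) measure, N, X). iid_with_index M N X \<and>
      (\<forall>s. norm s \<le> 1 \<longrightarrow> pgf M N s = wp_member \<phi> j k \<theta> s) \<and>
      (\<forall>t. char (sum_law M N X) t = wp_member \<phi> j k \<theta> (h \<theta> t))"
  have "\<forall>\<theta>\<in>\<Theta>. \<exists>T. ?P \<theta> T"
  proof
    fix \<theta> assume \<theta>: "\<theta> \<in> \<Theta>"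
    obtain M :: "(nat \<times> (nat \<Rightarrow> real)) measure" and N X where "iid_with_index M N X"
      "\<And>s. norm s \<le> 1 \<Longrightarrow> pgf M N s = wp_member (laplace_transform MZ Z) j k \<theta> s"
      "\<And>t. char (sum_law M N X) t = wp_member (laplace_transform MZ Z) j k \<theta> (h \<theta> t)"
      by (rule ex_wp_member_sum[OF MZ pos[OF \<theta>] h[OF \<theta>], of j k]) blast
    hence "?P \<theta> (M, N, X)" by (simp add: \<phi>)
    thus "\<exists>T. ?P \<theta> T" by (rule exI)
  qed
  then obtain T where T: "\<forall>\<theta>\<in>\<Theta>. ?P \<theta> (T \<theta>)" by (rule bchoice[THEN exE])
  define M where "M \<theta> = fst (T \<theta>)" for \<theta>
  define N where "N \<theta> = fst (snd (T \<theta>))" for \<theta>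
  define X where "X \<theta> = snd (snd (T \<theta>))" for \<theta>
  have P: "iid_with_index (M \<theta>) (N \<theta>) (X \<theta>)"
    "\<And>s. norm s \<le> 1 \<Longrightarrow> pgf (M \<theta>) (N \<theta>) s = wp_member \<phi> j k \<theta> s"
    "\<And>t. char (sum_law (M \<theta>) (N \<theta>) (X \<theta>)) t = wp_member \<phi> j k \<theta> (h \<theta> t)" if "\<theta> \<in> \<Theta>" for \<theta>
    using bspec[OF T that] by (simp_all add: M_def N_def X_def case_prod_beta)
  show ?thesis
  proof (rule that)
    fix \<theta>s :: "nat \<Rightarrow> real" assume \<theta>s: "\<And>n. \<theta>s n \<in> \<Theta>" "\<theta>s \<longlonglongrightarrow> 0"
    show "weak_conv_m (\<lambda>n. sum_law (M (\<theta>s n)) (N (\<theta>s n)) (X (\<theta>s n))) L"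
    proof (rule levy_continuity[OF real_distribution_sum_law[OF P(1)[OF \<theta>s(1)]] L])
      fix t
      show "(\<lambda>n. char (sum_law (M (\<theta>s n)) (N (\<theta>s n)) (X (\<theta>s n))) t) \<longlonglongrightarrow> char L t"
        unfolding P(3)[OF \<theta>s(1)] \<omega>(2) \<phi> h_def
        by (rule wp_member_root_tendsto[OF MZ k infinitely_divisible_cf_log_Re_le_0[OF \<omega>(1)] pos[OF \<theta>s(1)] \<theta>s(2)])
    qed
  qed (use P in auto)
qed

theorem theorem2p1:
  fixes \<Theta> :: "real set" and MZ :: "'z measure" and Z :: "'z \<Rightarrow> real"
    and \<phi> :: "complex \<Rightarrow> complex"
  assumes "\<Theta> \<subseteq> {0<..}" and "0 islimpt \<Theta>"
    and "prob_space MZ" and "Z \<in> borel_measurable MZ" and "AE x in MZ. Z x > 0"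
    and "\<phi> = laplace_transform MZ Z"
  shows
    "(\<forall>(j::nat) (k::nat) (M :: real \<Rightarrow> 'a measure) (N :: real \<Rightarrow> 'a \<Rightarrow> nat)
        (X :: real \<Rightarrow> nat \<Rightarrow> 'a \<Rightarrow> real) (\<theta>s :: nat \<Rightarrow> real) (\<kappa> :: nat \<Rightarrow> nat)
        (U :: real measure) (L :: real measure).
        k \<ge> 1 \<longrightarrow>
        (\<forall>\<theta>\<in>\<Theta>. iid_with_index (M \<theta>) (N \<theta>) (X \<theta>) \<and>
           (\<forall>s::real. 0 < s \<and> s < 1 \<longrightarrow>
              pgf (M \<theta>) (N \<theta>) (of_real s) = wp_member \<phi> j k \<theta> (of_real s))) \<longrightarrow>
        (\<forall>n. \<theta>s n \<in> \<Theta>) \<longrightarrow> decseq \<theta>s \<longrightarrow> \<theta>s \<longlonglongrightarrow> 0 \<longrightarrow>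
        real_distribution U \<longrightarrow> infinitely_divisible_cf (char U) \<longrightarrow>
        weak_conv_m (\<lambda>n. sum_law (M (\<theta>s n)) (\<lambda>_. \<kappa> n) (X (\<theta>s n))) U \<longrightarrow>
        real_distribution L \<longrightarrow>
        weak_conv_m (\<lambda>n. sum_law (M (\<theta>s n)) (N (\<theta>s n)) (X (\<theta>s n))) L \<longrightarrow>
        phi_ID \<Theta> \<phi> (char L))
     \<and>
     (\<forall>(L :: real measure) (j::nat) (k::nat).
        real_distribution L \<longrightarrow> phi_ID \<Theta> \<phi> (char L) \<longrightarrow> k \<ge> 1 \<longrightarrow>
        (\<exists>(M :: real \<Rightarrow> (nat \<times> (nat \<Rightarrow> real)) measure) N X.
           (\<forall>\<theta>\<in>\<Theta>. iid_with_index (M \<theta>) (N \<theta>) (X \<theta>) \<and>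
              (\<forall>s::real. 0 < s \<and> s < 1 \<longrightarrow>
                 pgf (M \<theta>) (N \<theta>) (of_real s) = wp_member \<phi> j k \<theta> (of_real s))) \<and>
           (\<forall>\<theta>s :: nat \<Rightarrow> real. (\<forall>n. \<theta>s n \<in> \<Theta>) \<longrightarrow> \<theta>s \<longlonglongrightarrow> 0 \<longrightarrow>
              weak_conv_m (\<lambda>n. sum_law (M (\<theta>s n)) (N (\<theta>s n)) (X (\<theta>s n))) L)))"
proof (intro conjI allI impI)
  fix j k :: nat and M :: "real \<Rightarrow> 'a measure" and N :: "real \<Rightarrow> 'a \<Rightarrow> nat"
    and X :: "real \<Rightarrow> nat \<Rightarrow> 'a \<Rightarrow> real" and \<theta>s :: "nat \<Rightarrow> real" and L :: "real measure"
  assume "k \<ge> 1" "\<forall>\<theta>\<in>\<Theta>. iid_with_index (M \<theta>) (N \<theta>) (X \<theta>) \<and>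
      (\<forall>s::real. 0 < s \<and> s < 1 \<longrightarrow> pgf (M \<theta>) (N \<theta>) (of_real s) = wp_member \<phi> j k \<theta> (of_real s))"
    "\<forall>n. \<theta>s n \<in> \<Theta>" "decseq \<theta>s" "\<theta>s \<longlonglongrightarrow> 0" "real_distribution L"
    "weak_conv_m (\<lambda>n. sum_law (M (\<theta>s n)) (N (\<theta>s n)) (X (\<theta>s n))) L"
  thus "phi_ID \<Theta> \<phi> (char L)"
    by (intro N_sum_limit_phi_ID[OF assms(1,3-6)]) auto
next
  fix L :: "real measure" and j k :: nat
  assume L: "real_distribution L" "phi_ID \<Theta> \<phi> (char L)" and k: "k \<ge> 1"
  obtain M :: "real \<Rightarrow> (nat \<times> (nat \<Rightarrow> real)) measure" and N X where
    *: "\<And>\<theta>. \<theta> \<in> \<Theta> \<Longrightarrow> iid_with_index (M \<theta>) (N \<theta>) (X \<theta>)"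
    "\<And>\<theta> s. \<theta> \<in> \<Theta> \<Longrightarrow> norm s \<le> 1 \<Longrightarrow> pgf (M \<theta>) (N \<theta>) s = wp_member \<phi> j k \<theta> s"
    "\<And>\<theta>s. (\<And>n. \<theta>s n \<in> \<Theta>) \<Longrightarrow> \<theta>s \<longlonglongrightarrow> 0 \<Longrightarrow>
       weak_conv_m (\<lambda>n. sum_law (M (\<theta>s n)) (N (\<theta>s n)) (X (\<theta>s n))) L"
    using phi_ID_N_sum_limit[OF assms(1,3-6) k L, where j = j] by blast
  show "\<exists>(M :: real \<Rightarrow> (nat \<times> (nat \<Rightarrow> real)) measure) N X.
      (\<forall>\<theta>\<in>\<Theta>. iid_with_index (M \<theta>) (N \<theta>) (X \<theta>) \<and>
        (\<forall>s::real. 0 < s \<and> s < 1 \<longrightarrow> pgf (M \<theta>) (N \<theta>) (of_real s) = wp_member \<phi> j k \<theta> (of_real s))) \<and>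
      (\<forall>\<theta>s :: nat \<Rightarrow> real. (\<forall>n. \<theta>s n \<in> \<Theta>) \<longrightarrow> \<theta>s \<longlonglongrightarrow> 0 \<longrightarrow>
        weak_conv_m (\<lambda>n. sum_law (M (\<theta>s n)) (N (\<theta>s n)) (X (\<theta>s n))) L)"
    by (intro exI[of _ M] exI[of _ N] exI[of _ X] conjI ballI allI impI *) auto
qed

end
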